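(* Let $N\ge 2$ be an integer. For every $0\le\alpha<\infty$ and every $0<\beta<\infty$, the random graph obtained from long-range percolation on the hierarchical lattice $\Omega_N$ with parameters $\alpha,\beta$ has, $\mathbb P_{\alpha,\beta}$-almost surely, at most one infinite cluster.
   Context: For an integer $N\ge 2$, the hierarchical lattice of order $N$ is the countable set $\Omega_N=\{\mathbf x=(x_1,x_2,\ldots): x_i\in\{0,1,\ldots,N-1\},\ \sum_i x_i<\infty\}$ with the (ultra)metric $d(\mathbf x,\mathbf x)=0$ and $d(\mathbf x,\mathbf y)=\max\{i: x_i\ne y_i\}$ for $\mathbf x\ne \mathbf y$. Long-range percolation on $\Omega_N$ with parameters $0\le\alpha<\infty$ and $0<\beta<\infty$: each unordered pair of distinct vertices $x,y\in\Omega_N$ is, independently of all other pairs, joined by an (undirected) edge with probability $p_k=1-\exp(-\alpha/\beta^{k})$, where $k=d(x,y)$. The law is denoted $\mathbb P_{\alpha,\beta}$. A cluster is a connected component of the resulting random graph (two vertices are in the same component if a finite path of present edges joins them). *)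

theory Defs
  imports "HOL-Probability.Probability"
begin

(* Coordinates are indexed from 0, so x i is the (i+1)-st coordinate of x;
   this is the reason for the Suc in hdist. *)

definition hlattice :: "nat \<Rightarrow> (nat \<Rightarrow> nat) set" where
  "hlattice N = {x. (\<forall>i. x i < N) \<and> summable (\<lambda>i. real (x i))}"

definition hdist :: "(nat \<Rightarrow> nat) \<Rightarrow> (nat \<Rightarrow> nat) \<Rightarrow> nat" where
  "hdist x y = (if x = y then 0 else Max {Suc i |i. x i \<noteq> y i})"

definition hedges :: "nat \<Rightarrow> (nat \<Rightarrow> nat) set set" where
  "hedges N = {{x, y} |x y. x \<in> hlattice N \<and> y \<in> hlattice N \<and> x \<noteq> y}"

definition edge_length :: "(nat \<Rightarrow> nat) set \<Rightarrow> nat" where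
  "edge_length e = (THE k. \<exists>x y. e = {x, y} \<and> x \<noteq> y \<and> k = hdist x y)"

definition edge_prob :: "real \<Rightarrow> real \<Rightarrow> nat \<Rightarrow> real" where
  "edge_prob \<alpha> \<beta> k = 1 - exp (- (\<alpha> / \<beta> ^ k))"

definition percolation :: "nat \<Rightarrow> real \<Rightarrow> real \<Rightarrow> ((nat \<Rightarrow> nat) set \<Rightarrow> bool) measure" where
  "percolation N \<alpha> \<beta> =
     (\<Pi>\<^sub>M e\<in>hedges N. measure_pmf (bernoulli_pmf (edge_prob \<alpha> \<beta> (edge_length e))))"

definition adjacent ::
  "nat \<Rightarrow> ((nat \<Rightarrow> nat) set \<Rightarrow> bool) \<Rightarrow> (nat \<Rightarrow> nat) \<Rightarrow> (nat \<Rightarrow> nat) \<Rightarrow> bool" where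
  "adjacent N \<omega> x y \<longleftrightarrow> {x, y} \<in> hedges N \<and> \<omega> {x, y}"

definition cluster ::
  "nat \<Rightarrow> ((nat \<Rightarrow> nat) set \<Rightarrow> bool) \<Rightarrow> (nat \<Rightarrow> nat) \<Rightarrow> (nat \<Rightarrow> nat) set" where
  "cluster N \<omega> x = {y. (adjacent N \<omega>)\<^sup>*\<^sup>* x y}"

definition clusters :: "nat \<Rightarrow> ((nat \<Rightarrow> nat) set \<Rightarrow> bool) \<Rightarrow> (nat \<Rightarrow> nat) set set" where
  "clusters N \<omega> = cluster N \<omega> ` hlattice N"

lemma summable_nat_iff_finite_support:
  fixes x :: "nat \<Rightarrow> nat"
  shows "summable (\<lambda>i. real (x i)) \<longleftrightarrow> finite {i. x i \<noteq> 0}"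
proof
  assume "summable (\<lambda>i. real (x i))"
  then have "(\<lambda>i. real (x i)) \<longlonglongrightarrow> 0"
    by (rule summable_LIMSEQ_zero)
  then have "eventually (\<lambda>i. real (x i) < 1) sequentially"
    by (rule order_tendstoD) simp
  then obtain n where n: "\<And>i. i \<ge> n \<Longrightarrow> real (x i) < 1"
    by (auto simp: eventually_sequentially)
  have "{i. x i \<noteq> 0} \<subseteq> {..<n}"
    using n by (force simp: not_less[symmetric])
  then show "finite {i. x i \<noteq> 0}"
    by (rule finite_subset) simp
next
  assume "finite {i. x i \<noteq> 0}"
  then show "summable (\<lambda>i. real (x i))"
    by (rule summable_finite) auto
qed

lemma finite_differing_coordinates:
  assumes "x \<in> hlattice N" "y \<in> hlattice N"
  shows "finite {i. x i \<noteq> y i}"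
proof (rule finite_subset)
  show "{i. x i \<noteq> y i} \<subseteq> {i. x i \<noteq> 0} \<union> {i. y i \<noteq> 0}"
    by auto
  show "finite ({i. x i \<noteq> 0} \<union> {i. y i \<noteq> 0})"
    using assms by (simp add: hlattice_def summable_nat_iff_finite_support)
qed

lemma hdist_commute: "hdist x y = hdist y x"
  by (simp add: hdist_def eq_commute)

lemma edge_length_insert [simp]:
  assumes "x \<noteq> y"
  shows "edge_length {x, y} = hdist x y"
  unfolding edge_length_def
  by (rule the_equality) (use assms hdist_commute in \<open>auto simp: doubleton_eq_iff\<close>)

lemma edge_prob_bounds:
  assumes "0 \<le> \<alpha>" "0 < \<beta>"
  shows "0 \<le> edge_prob \<alpha> \<beta> k" "edge_prob \<alpha> \<beta> k \<le> 1"
  using assms by (simp_all add: edge_prob_def)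

lemma prob_space_percolation: "prob_space (percolation N \<alpha> \<beta>)"
  unfolding percolation_def by (intro prob_space_PiM measure_pmf.prob_space_axioms)

lemma prob_edge_open:
  assumes "0 \<le> \<alpha>" "0 < \<beta>" "x \<in> hlattice N" "y \<in> hlattice N" "x \<noteq> y"
  shows "measure (percolation N \<alpha> \<beta>) {\<omega> \<in> space (percolation N \<alpha> \<beta>). \<omega> {x, y}}
           = edge_prob \<alpha> \<beta> (hdist x y)"
proof -
  let ?M = "\<lambda>e. measure_pmf (bernoulli_pmf (edge_prob \<alpha> \<beta> (edge_length e)))"
  interpret product_prob_space ?M "hedges N"
    by (intro product_prob_spaceI measure_pmf.prob_space_axioms)
  have e: "{x, y} \<in> hedges N"
    using assms by (auto simp: hedges_def)
  have "measure (percolation N \<alpha> \<beta>) {\<omega> \<in> space (percolation N \<alpha> \<beta>). \<omega> {x, y} \<in> {True}}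
      = measure (?M {x, y}) {True}"
    unfolding percolation_def
    using emeasure_PiM_Collect_single[OF e, of "{True}"] by (simp add: measure_def)
  then show ?thesis
    using assms edge_prob_bounds[OF assms(1,2)] by (simp add: measure_pmf_single)
qed

end

theory Submission
  imports Defs
begin

text \<open>
  Write \<open>w n = (N / \<beta>) ^ n\<close> and let \<open>hball N n\<close> be the ball of radius \<open>n\<close> around the origin. The expected
  number of open edges leaving a set \<open>S\<close> in the ball is at most of order \<open>card S * w n\<close> if \<open>\<beta> > N\<close>, and
  these edges are independent of the configuration inside the ball; if \<open>\<beta> \<le> N\<close> then \<open>w n\<close> is at least 1. Hence a vertex of an infinite cluster
  has, with probability tending to 1, a cluster inside the ball of size at least \<open>K / w n\<close>, for every \<open>K\<close>.

  Suppose infinite clusters occur with positive probability. By transitivity, with probability bounded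
  below a positive fraction of the vertices of the ball, and of those of a sibling ball, lie in internal
  clusters of size at least \<open>K / w n\<close>. There are at most \<open>2 * N ^ n * w n / K\<close> such clusters, so for large \<open>K\<close>
  a union bound over the unions of such clusters shows that the edges between the two balls create a cluster
  containing a positive fraction \<open>\<delta>\<close> of all vertices.

  Now let \<open>x\<close> and \<open>y\<close> lie in infinite clusters. Given the configuration in the ball, the clusters of \<open>x\<close> and \<open>y\<close>
  in the ball have size at least \<open>K / w n\<close>, the sibling ball has a cluster of size \<open>\<delta> * N ^ n\<close> with probability
  bounded below, and then it is joined to both with probability at least \<open>1 / 2\<close>. So the conditional
  probability that \<open>x\<close> and \<open>y\<close> are in distinct infinite clusters stays away from 1 for all \<open>n\<close>, which is only
  possible for an event of probability 0.
\<close>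


section \<open>Events of product measures determined by few coordinates\<close>

text \<open>The sets range over all functions, not only those in the product space, and
  \<open>J\<close> may be infinite. Measurability is therefore a separate matter, settled after
  intersecting with \<open>space P\<close>.\<close>

definition determined_by :: "'i set \<Rightarrow> ('i \<Rightarrow> bool) set \<Rightarrow> bool" where
  "determined_by J A \<longleftrightarrow> (\<forall>\<omega> \<omega>'. (\<forall>i\<in>J. \<omega> i = \<omega>' i) \<longrightarrow> (\<omega> \<in> A \<longleftrightarrow> \<omega>' \<in> A))"

lemma determined_byD:
  "determined_by J A \<Longrightarrow> (\<And>i. i \<in> J \<Longrightarrow> \<omega> i = \<omega>' i) \<Longrightarrow> \<omega> \<in> A \<longleftrightarrow> \<omega>' \<in> A"
  unfolding determined_by_def by blast

lemma determined_by_mono: "determined_by J A \<Longrightarrow> J \<subseteq> K \<Longrightarrow> determined_by K A"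
  unfolding determined_by_def by blast

lemma determined_by_Int: "determined_by J A \<Longrightarrow> determined_by J B \<Longrightarrow> determined_by J (A \<inter> B)"
  unfolding determined_by_def by blast

lemma determined_by_Un: "determined_by J A \<Longrightarrow> determined_by J B \<Longrightarrow> determined_by J (A \<union> B)"
  unfolding determined_by_def by blast

lemma determined_by_Diff: "determined_by J A \<Longrightarrow> determined_by J B \<Longrightarrow> determined_by J (A - B)"
  unfolding determined_by_def by blast

lemma determined_by_UN: "(\<And>k. k \<in> K \<Longrightarrow> determined_by J (A k)) \<Longrightarrow> determined_by J (\<Union>k\<in>K. A k)"
  unfolding determined_by_def by auto

lemma determined_by_UNIV: "determined_by J UNIV"
  unfolding determined_by_def by simp

section \<open>Bernoulli product measures: cylinders, independence and conditioning\<close>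

locale bernoulli_product =
  fixes I :: "'i set" and p :: "'i \<Rightarrow> real"
  assumes p_nonneg: "i \<in> I \<Longrightarrow> 0 \<le> p i" and p_le_1: "i \<in> I \<Longrightarrow> p i \<le> 1"
begin

definition P where "P = (\<Pi>\<^sub>M i\<in>I. measure_pmf (bernoulli_pmf (p i)))"

sublocale prob_space P
  unfolding P_def by (intro prob_space_PiM measure_pmf.prob_space_axioms)

lemma space_P: "space P = I \<rightarrow>\<^sub>E UNIV"
  by (simp add: P_def space_PiM)

lemma component_measurable [measurable]: "i \<in> I \<Longrightarrow> (\<lambda>\<omega>. \<omega> i) \<in> P \<rightarrow>\<^sub>M count_space UNIV"
  using measurable_component_singleton[of i I "\<lambda>i. measure_pmf (bernoulli_pmf (p i))"]
  by (simp add: P_def)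

lemma atom_measurable:
  assumes "finite J" "J \<subseteq> I"
  shows "{\<omega>\<in>space P. \<forall>i\<in>J. \<omega> i = \<eta> i} \<in> sets P"
proof -
  have "{\<omega>\<in>space P. \<omega> i = \<eta> i} \<in> sets P" if "i \<in> J" for i
  proof -
    have "(\<lambda>\<omega>. \<omega> i) -` {\<eta> i} \<inter> space P \<in> sets P"
      using that assms by (intro measurable_sets[OF component_measurable]) auto
    then show ?thesis by (simp add: vimage_def Int_def conj_commute)
  qed
  then show ?thesis using assms by (intro sets.sets_Collect_finite_All) auto
qed

text \<open>Agreeing on \<open>J\<close> with one member of \<open>A\<close> decides membership in
  \<open>A\<close>. For finite \<open>J\<close> only finitely many cylinders occur, which gives
  measurability and a partition to condition on.\<close>

lemma Int_space_eq_Union_atoms: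
  assumes "determined_by J A"
  shows "A \<inter> space P =
    (\<Union>\<eta>\<in>(\<lambda>\<omega>. restrict \<omega> J) ` (A \<inter> space P). {\<omega>\<in>space P. \<forall>i\<in>J. \<omega> i = \<eta> i})"
    (is "?l = ?r")
proof
  show "?l \<subseteq> ?r" by auto
  show "?r \<subseteq> ?l"
  proof
    fix \<omega> assume "\<omega> \<in> ?r"
    then obtain \<omega>' where *: "\<omega>' \<in> A" "\<omega> \<in> space P" "\<And>i. i \<in> J \<Longrightarrow> \<omega> i = \<omega>' i" by auto
    then show "\<omega> \<in> ?l" using determined_byD[OF assms, of \<omega> \<omega>'] by auto
  qed
qed

lemma finite_restrictions:
  assumes "finite J"
  shows "finite ((\<lambda>\<omega>. restrict \<omega> J) ` (X :: ('i \<Rightarrow> bool) set))"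
proof (rule finite_subset)
  show "(\<lambda>\<omega>. restrict \<omega> J) ` X \<subseteq> J \<rightarrow>\<^sub>E UNIV" by auto
  show "finite (J \<rightarrow>\<^sub>E (UNIV :: bool set))" using assms by (intro finite_PiE) auto
qed

lemma determined_by_measurable:
  assumes "finite J" "J \<subseteq> I" "determined_by J A"
  shows "A \<inter> space P \<in> sets P"
  by (subst Int_space_eq_Union_atoms[OF assms(3)])
     (intro sets.finite_UN finite_restrictions assms atom_measurable)

text \<open>Restrictions of the configuration to disjoint coordinate sets are independent, and each
  event is a preimage under its restriction. Infinite index sets are allowed, so measurability is
  assumed instead of derived.\<close>

lemma determined_by_indep:
  assumes A: "A \<inter> space P \<in> sets P" "determined_by J A" "J \<subseteq> I"
    and B: "B \<inter> space P \<in> sets P" "determined_by K B" "K \<subseteq> I" and "J \<inter> K = {}"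
  shows "prob (A \<inter> B \<inter> space P) = prob (A \<inter> space P) * prob (B \<inter> space P)"
proof -
  let ?M = "\<lambda>i. measure_pmf (bernoulli_pmf (p i))"
  have pps: "product_prob_space ?M"
    by (intro product_prob_spaceI measure_pmf.prob_space_axioms)
  have ind: "indep_var (PiM J ?M) (\<lambda>\<omega>. restrict (\<lambda>i. \<omega> i) J) (PiM K ?M) (\<lambda>\<omega>. restrict (\<lambda>i. \<omega> i) K)"
  proof (rule indep_var_restrict[OF _ assms(7,3,6)])
    show "indep_vars ?M (\<lambda>x \<omega>. \<omega> x) I"
    proof (cases "I = {}")
      case True
      then show ?thesis
        unfolding indep_vars_def indep_sets_def by auto
    next
      case False
      have "distr P (PiM I ?M) (\<lambda>x. \<lambda>i\<in>I. x i) = distr P P (\<lambda>x. x)"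
        by (intro distr_cong) (auto simp: P_def space_PiM)
      then show ?thesis
        by (subst indep_vars_iff_distr_eq_PiM'[OF False])
           (use component_measurable in \<open>auto simp: P_def distr_id2 product_prob_space.PiM_component[OF pps] intro!: PiM_cong\<close>)
    qed
  qed
  \<comment> \<open>Extension by \<open>False\<close> is a measurable right inverse of the
    restriction to \<open>L\<close>. Pulling an event determined by \<open>L\<close> back along it
    yields a measurable set of partial configurations.\<close>
  have ext: "(\<lambda>g. \<lambda>i\<in>I. if i \<in> L then g i else False) \<in> PiM L ?M \<rightarrow>\<^sub>M P" if "L \<subseteq> I" for L
    unfolding P_def
  proof (rule measurable_restrict)
    fix i assume "i \<in> I"
    show "(\<lambda>g. if i \<in> L then g i else False) \<in> PiM L ?M \<rightarrow>\<^sub>M ?M i"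
      using measurable_component_singleton[of i L ?M] by (cases "i \<in> L") simp_all
  qed
  have pre: "\<exists>C \<in> sets (PiM L ?M). X \<inter> space P = (\<lambda>\<omega>. restrict (\<lambda>i. \<omega> i) L) -` C \<inter> space P"
    if X: "X \<inter> space P \<in> sets P" "determined_by L X" "L \<subseteq> I" for L X
  proof (intro bexI)
    let ?e = "\<lambda>g. \<lambda>i\<in>I. if i \<in> L then g i else False"
    show "?e -` (X \<inter> space P) \<inter> space (PiM L ?M) \<in> sets (PiM L ?M)"
      using measurable_sets[OF ext[OF X(3)] X(1)] .
    have "?e (restrict (\<lambda>i. \<omega> i) L) \<in> X \<longleftrightarrow> \<omega> \<in> X" for \<omega>
      using X(3) by (intro determined_byD[OF X(2)]) auto
    moreover have "?e (restrict (\<lambda>i. \<omega> i) L) \<in> space P" for \<omega>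
      unfolding space_P by simp
    moreover have "restrict (\<lambda>i. \<omega> i) L \<in> space (PiM L ?M)" for \<omega>
      by (simp add: space_PiM)
    ultimately show "X \<inter> space P = (\<lambda>\<omega>. restrict (\<lambda>i. \<omega> i) L) -` (?e -` (X \<inter> space P) \<inter> space (PiM L ?M)) \<inter> space P"
      unfolding vimage_def by (intro set_eqI) (simp only: Int_iff mem_Collect_eq simp_thms)
  qed
  obtain C D where C: "C \<in> sets (PiM J ?M)" "A \<inter> space P = (\<lambda>\<omega>. restrict (\<lambda>i. \<omega> i) J) -` C \<inter> space P"
    and D: "D \<in> sets (PiM K ?M)" "B \<inter> space P = (\<lambda>\<omega>. restrict (\<lambda>i. \<omega> i) K) -` D \<inter> space P"
    using pre[OF A] pre[OF B] by blast
  have "A \<inter> B \<inter> space P = (\<lambda>\<omega>. (restrict (\<lambda>i. \<omega> i) J, restrict (\<lambda>i. \<omega> i) K)) -` (C \<times> D) \<inter> space P"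
    using C(2) D(2) by blast
  then show ?thesis
    using indep_varD[OF ind C(1) D(1)] by (simp add: C(2) D(2))
qed

lemma prob_all_closed:
  assumes "finite J" "J \<subseteq> I"
  shows "prob {\<omega>\<in>space P. \<forall>i\<in>J. \<not> \<omega> i} = (\<Prod>i\<in>J. 1 - p i)"
proof -
  let ?M = "\<lambda>i. measure_pmf (bernoulli_pmf (p i))"
  have pps: "product_prob_space ?M"
    by (intro product_prob_spaceI measure_pmf.prob_space_axioms)
  have "emeasure P {\<omega>\<in>space P. \<forall>i\<in>J. \<not> \<omega> i} = (\<Prod>i\<in>J. emeasure (?M i) {False})"
    using product_prob_space.emeasure_PiM_Collect[OF pps assms(2,1), of "\<lambda>_. {False}"] by (simp add: P_def)
  then have "prob {\<omega>\<in>space P. \<forall>i\<in>J. \<not> \<omega> i} = (\<Prod>i\<in>J. measure (?M i) {False})"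
    by (simp add: measure_pmf.emeasure_eq_measure emeasure_eq_measure prod_ennreal prod_nonneg)
  also have "\<dots> = (\<Prod>i\<in>J. 1 - p i)"
    using assms p_nonneg p_le_1 by (intro prod.cong) (auto simp: measure_pmf_single subset_iff)
  finally show ?thesis .
qed

text \<open>Elementary conditioning on the coordinates in \<open>J\<close>: on the cylinder of
  \<open>\<eta>\<close> the event \<open>E\<close> is contained in \<open>D\<close>, which is
  independent of that cylinder. \<open>D\<close> may vary with \<open>\<eta>\<close>; summing over
  the cylinders that make up \<open>B\<close> gives the bound.\<close>

lemma prob_Int_le_of_atoms:
  assumes J: "finite J" "J \<subseteq> I" and B: "determined_by J B" and E: "E \<inter> space P \<in> sets P"
    and ex: "\<And>\<eta>. \<eta> \<in> B \<Longrightarrow> \<eta> \<in> space P \<Longrightarrow> \<exists>D. D \<inter> space P \<in> sets P \<and> determined_by (I - J) D \<and>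
      prob (D \<inter> space P) \<le> r \<and> (\<forall>\<omega>\<in>space P. (\<forall>i\<in>J. \<omega> i = \<eta> i) \<longrightarrow> \<omega> \<in> E \<longrightarrow> \<omega> \<in> D)"
  shows "prob (B \<inter> E \<inter> space P) \<le> r * prob (B \<inter> space P)"
proof -
  let ?R = "(\<lambda>\<omega>. restrict \<omega> J) ` (B \<inter> space P)"
  define At where "At \<eta> = {\<omega>\<in>space P. \<forall>i\<in>J. \<omega> i = \<eta> i}" for \<eta> :: "'i \<Rightarrow> bool"
  have At: "At \<eta> \<in> sets P" for \<eta> unfolding At_def by (rule atom_measurable[OF J])
  have fin: "finite ?R" by (rule finite_restrictions[OF J(1)])
  have disj: "disjoint_family_on At ?R"
    unfolding disjoint_family_on_def
  proof (intro ballI impI)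
    fix m n assume "m \<in> ?R" "n \<in> ?R" "m \<noteq> n"
    then have "\<exists>i\<in>J. m i \<noteq> n i" by (auto simp: fun_eq_iff restrict_def split: if_splits)
    then show "At m \<inter> At n = {}" by (auto simp: At_def)
  qed
  have Beq: "B \<inter> space P = (\<Union>\<eta>\<in>?R. At \<eta>)"
    using Int_space_eq_Union_atoms[OF B] by (simp add: At_def)
  then have "B \<inter> E \<inter> space P = (\<Union>\<eta>\<in>?R. At \<eta> \<inter> (E \<inter> space P))" by blast
  then have "prob (B \<inter> E \<inter> space P) = (\<Sum>\<eta>\<in>?R. prob (At \<eta> \<inter> (E \<inter> space P)))"
    using At E fin disj
    by (simp only:) (rule finite_measure_finite_Union, auto intro: disjoint_family_on_bisimulation)
  also have "\<dots> \<le> (\<Sum>\<eta>\<in>?R. r * prob (At \<eta>))"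
  proof (rule sum_mono)
    fix \<eta> assume "\<eta> \<in> ?R"
    then obtain \<eta>' where \<eta>': "\<eta>' \<in> B" "\<eta>' \<in> space P" "\<eta> = restrict \<eta>' J" by blast
    obtain D where D: "D \<inter> space P \<in> sets P" "determined_by (I - J) D"
      "prob (D \<inter> space P) \<le> r" "\<forall>\<omega>\<in>space P. (\<forall>i\<in>J. \<omega> i = \<eta>' i) \<longrightarrow> \<omega> \<in> E \<longrightarrow> \<omega> \<in> D"
      using ex[OF \<eta>'(1,2)] by (elim exE conjE)
    let ?A = "{\<omega>. \<forall>i\<in>J. \<omega> i = \<eta> i}"
    have A: "?A \<inter> space P = At \<eta>" by (auto simp: At_def)
    have "prob (At \<eta> \<inter> (E \<inter> space P)) \<le> prob (?A \<inter> D \<inter> space P)"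
    proof (rule finite_measure_mono)
      show "At \<eta> \<inter> (E \<inter> space P) \<subseteq> ?A \<inter> D \<inter> space P" using D(4) \<eta>'(3) by (auto simp: At_def)
      have "?A \<inter> D \<inter> space P = At \<eta> \<inter> (D \<inter> space P)" using A by blast
      then show "?A \<inter> D \<inter> space P \<in> sets P" using At D(1) by simp
    qed
    also have "\<dots> = prob (?A \<inter> space P) * prob (D \<inter> space P)"
      by (rule determined_by_indep[OF _ _ J(2) D(1,2)]) (use At A in \<open>auto simp: determined_by_def\<close>)
    also have "\<dots> \<le> r * prob (At \<eta>)"
      using mult_right_mono[OF D(3), of "prob (At \<eta>)"] by (simp add: A mult.commute)
    finally show "prob (At \<eta> \<inter> (E \<inter> space P)) \<le> r * prob (At \<eta>)" .
  qed
  also have "\<dots> = r * prob (B \<inter> space P)"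
  proof -
    have "At ` ?R \<subseteq> sets P" using At by blast
    from finite_measure_finite_Union[OF fin this disj]
    have "prob (B \<inter> space P) = (\<Sum>\<eta>\<in>?R. prob (At \<eta>))" by (subst Beq)
    then show ?thesis by (simp add: sum_distrib_left)
  qed
  finally show ?thesis .
qed

section \<open>Approximation of measurable events by finite cylinder events\<close>

definition approximable :: "(nat \<Rightarrow> 'i set) \<Rightarrow> ('i \<Rightarrow> bool) set \<Rightarrow> bool" where
  "approximable J E \<longleftrightarrow> (\<forall>\<epsilon>>0. \<exists>n D. determined_by (J n) D \<and> prob (sym_diff D E \<inter> space P) < \<epsilon>)"

text \<open>Being measurable and approximable holds for one-coordinate events and is stable under
  complements and countable unions, hence it holds on the generated sigma-algebra.\<close>

lemma measurable_approximable:
  assumes J: "\<And>n. finite (J n)" "\<And>n. J n \<subseteq> I" "incseq J" "(\<Union>n. J n) = I" and E: "E \<in> sets P"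
  shows "approximable J E"
proof -
  let ?M = "\<lambda>i. measure_pmf (bernoulli_pmf (p i))"
  let ?G = "{{f\<in>\<Pi>\<^sub>E i\<in>I. space (?M i). f i \<in> A} | i A. i \<in> I \<and> A \<in> sets (?M i)}"
  have detm: "D \<inter> space P \<in> sets P" if "determined_by (J n) D" for n D
    using determined_by_measurable[OF J(1,2) that] .
  have sets_eq: "sets P = sigma_sets (\<Pi>\<^sub>E i\<in>I. space (?M i)) ?G"
    unfolding P_def by (rule sets_PiM_single)
  have "E \<in> sigma_sets (\<Pi>\<^sub>E i\<in>I. space (?M i)) ?G" using E by (simp add: sets_eq)
  then have "E \<in> sets P \<and> approximable J E"
  proof (induction rule: sigma_sets.induct)
    case (Basic a)
    then obtain i A where i: "i \<in> I" and a: "a = {f\<in>\<Pi>\<^sub>E i\<in>I. space (?M i). f i \<in> A}" by blast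
    have aP: "a = {\<omega>. \<omega> i \<in> A} \<inter> space P" unfolding a by (auto simp: space_P)
    obtain n where "i \<in> J n" using i J(4) by blast
    then have det: "determined_by (J n) {\<omega>. \<omega> i \<in> A}" by (auto simp: determined_by_def)
    have "sym_diff {\<omega>. \<omega> i \<in> A} a \<inter> space P = {}" unfolding aP by blast
    then show ?case using det detm[OF det] unfolding approximable_def aP[symmetric]
      by (metis measure_empty)
  next
    case Empty
    show ?case unfolding approximable_def
      by (auto intro!: exI[of _ "{}"] simp: determined_by_def)
  next
    case (Compl a)
    have sp: "(\<Pi>\<^sub>E i\<in>I. space (?M i)) = space P" by (simp add: space_P)
    show ?case unfolding sp approximable_def
    proof (intro conjI allI impI)
      show "space P - a \<in> sets P" using Compl by auto
      fix \<epsilon> :: real assume "\<epsilon> > 0"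
      then obtain n D where D: "determined_by (J n) D" "prob (sym_diff D a \<inter> space P) < \<epsilon>"
        using Compl unfolding approximable_def by blast
      have "sym_diff (UNIV - D) (space P - a) \<inter> space P = sym_diff D a \<inter> space P" by blast
      then show "\<exists>n D. determined_by (J n) D \<and> prob (sym_diff D (space P - a) \<inter> space P) < \<epsilon>"
        using D determined_by_Diff[OF determined_by_UNIV D(1)] by metis
    qed
  next
    case (Union a)
    then have am: "range a \<subseteq> sets P" by auto
    show ?case unfolding approximable_def
    proof (intro conjI allI impI)
      show "\<Union> (range a) \<in> sets P" using am by (intro sets.countable_UN) auto
      fix \<epsilon> :: real assume \<epsilon>: "\<epsilon> > 0"
      let ?U = "\<lambda>n. \<Union>k\<in>{..<n}. a k"
      have Um: "?U n \<in> sets P" for n using am by auto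
      have UU: "(\<Union>n. ?U n) = (\<Union>n. a n)" by auto
      have "(\<lambda>n. prob (?U n)) \<longlonglongrightarrow> prob (\<Union>n. ?U n)"
        using am by (intro finite_Lim_measure_incseq) (auto simp: incseq_def, force)
      then have "eventually (\<lambda>n. prob (?U n) > prob (\<Union>n. a n) - \<epsilon>/2) sequentially"
        unfolding UU using \<epsilon> by (intro order_tendstoD) auto
      then obtain n where n: "prob (?U n) > prob (\<Union>n. a n) - \<epsilon>/2"
        by (auto simp: eventually_sequentially)
      \<comment> \<open>The denominator uses \<open>n + 1\<close> so that \<open>\<delta>\<close> is
        positive also for \<open>n = 0\<close>; the \<open>n\<close> errors still add up to at most
        \<open>\<epsilon>/2\<close>.\<close>
      define \<delta> where "\<delta> = \<epsilon> / (2 * (real n + 1))"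
      have \<delta>: "\<delta> > 0" using \<epsilon> by (simp add: \<delta>_def)
      have "\<exists>m D. determined_by (J m) D \<and> prob (sym_diff D (a k) \<inter> space P) < \<delta>" for k
        using Union \<delta> unfolding approximable_def by blast
      then obtain m D where D: "\<And>k. determined_by (J (m k)) (D k)"
        "\<And>k. prob (sym_diff (D k) (a k) \<inter> space P) < \<delta>" by metis
      \<comment> \<open>The sum is a convenient upper bound for all the \<open>m k\<close>, so that
        monotonicity of \<open>J\<close> puts the finitely many approximations on one index
        set.\<close>
      define mm where "mm = (\<Sum>k<n. m k)"
      have mm: "determined_by (J mm) (\<Union>k\<in>{..<n}. D k)"
      proof (rule determined_by_UN)
        fix k assume "k \<in> {..<n}"
        then have "m k \<le> mm" unfolding mm_def by (intro member_le_sum) auto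
        then show "determined_by (J mm) (D k)"
          using D(1) J(3) by (meson determined_by_mono incseqD)
      qed
      have Sm: "sym_diff (D k) (a k) \<inter> space P \<in> sets P" for k
      proof -
        have "sym_diff (D k) (a k) \<inter> space P = ((D k \<inter> space P) - a k) \<union> (a k - (D k \<inter> space P))"
          using am sets.sets_into_space[of "a k" P] by auto
        then show ?thesis using am detm[OF D(1)[of k]] by auto
      qed
      have dm: "(\<Union>n. a n) - ?U n \<in> sets P" using am by auto
      have "prob (sym_diff (\<Union>k\<in>{..<n}. D k) (\<Union>n. a n) \<inter> space P)
          \<le> prob ((\<Union>k\<in>{..<n}. sym_diff (D k) (a k) \<inter> space P) \<union> ((\<Union>n. a n) - ?U n))"
      proof (rule finite_measure_mono)
        show "(\<Union>k\<in>{..<n}. sym_diff (D k) (a k) \<inter> space P) \<union> ((\<Union>n. a n) - ?U n) \<in> sets P"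
          by (rule sets.Un[OF sets.finite_UN dm], simp, rule Sm)
        show "sym_diff (\<Union>k\<in>{..<n}. D k) (\<Union>n. a n) \<inter> space P
          \<subseteq> (\<Union>k\<in>{..<n}. sym_diff (D k) (a k) \<inter> space P) \<union> ((\<Union>n. a n) - ?U n)"
          by blast
      qed
      also have "\<dots> \<le> prob (\<Union>k\<in>{..<n}. sym_diff (D k) (a k) \<inter> space P) + prob ((\<Union>n. a n) - ?U n)"
        by (rule measure_Un_le[OF sets.finite_UN dm], simp, rule Sm)
      also have "prob ((\<Union>n. a n) - ?U n) = prob (\<Union>n. a n) - prob (?U n)"
        using am by (intro finite_measure_Diff) auto
      also have "\<dots> < \<epsilon>/2" using n by simp
      also have "prob (\<Union>k\<in>{..<n}. sym_diff (D k) (a k) \<inter> space P)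
          \<le> (\<Sum>k<n. prob (sym_diff (D k) (a k) \<inter> space P))"
        by (rule finite_measure_subadditive_finite, simp, rule image_subsetI, rule Sm)
      also have "\<dots> \<le> (\<Sum>k<n. \<delta>)" using D(2) by (intro sum_mono less_imp_le)
      also have "\<dots> \<le> \<epsilon>/2" using \<epsilon> by (simp add: \<delta>_def field_simps)
      finally show "\<exists>n D. determined_by (J n) D \<and> prob (sym_diff D (\<Union> (range a)) \<inter> space P) < \<epsilon>"
        using mm by (intro exI[of _ mm] exI[of _ "\<Union>k\<in>{..<n}. D k"]) auto
    qed
  qed
  then show ?thesis by blast
qed

text \<open>A substitute for Levy's 0-1 law: if the conditional probability of \<open>E\<close> given the first \<open>n\<close>
  blocks of coordinates stays away from 1 on \<open>A n\<close>, then \<open>E\<close> and \<open>A n\<close> are asymptotically disjoint.\<close>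

lemma prob_Int_tendsto_0:
  assumes J: "\<And>n. finite (J n)" "\<And>n. J n \<subseteq> I" "incseq J" "(\<Union>n. J n) = I"
    and E: "E \<inter> space P \<in> sets P" and A: "\<And>n. determined_by (J n) (A n)" and c: "0 < c" "c \<le> 1"
    and le: "\<And>n B. n \<ge> n0 \<Longrightarrow> determined_by (J n) B \<Longrightarrow> B \<subseteq> A n \<Longrightarrow>
      prob (B \<inter> E \<inter> space P) \<le> (1 - c) * prob (B \<inter> space P)"
  shows "(\<lambda>n. prob (A n \<inter> E \<inter> space P)) \<longlonglongrightarrow> 0"
proof (rule LIMSEQ_I)
  fix r :: real assume "r > 0"
  \<comment> \<open>Chosen so that the bound \<open>2 * \<epsilon>\<close> on \<open>c\<close> times
    the probability says that the probability is below \<open>r\<close>.\<close>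
  define \<epsilon> where "\<epsilon> = c * r / 2"
  have \<epsilon>: "\<epsilon> > 0" using c \<open>r > 0\<close> by (simp add: \<epsilon>_def)
  obtain m D where D: "determined_by (J m) D" "prob (sym_diff D (E \<inter> space P) \<inter> space P) < \<epsilon>"
    using measurable_approximable[OF J E] \<epsilon> unfolding approximable_def by blast
  let ?S = "sym_diff D (E \<inter> space P) \<inter> space P"
  have Dm: "D \<inter> space P \<in> sets P" using determined_by_measurable[OF J(1,2) D(1)] .
  have S_eq: "?S = ((D \<inter> space P) - (E \<inter> space P)) \<union> ((E \<inter> space P) - (D \<inter> space P))" by blast
  have Sm: "?S \<in> sets P" unfolding S_eq using Dm E by blast
  \<comment> \<open>Let \<open>a\<close> be the probability of \<open>A n \<inter> E\<close>.
    Replacing \<open>E\<close> by its approximation \<open>D\<close> costs less than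
    \<open>\<epsilon>\<close>, the hypothesis for \<open>A n \<inter> D\<close> gains the factor
    \<open>1 - c\<close>, and returning to \<open>E\<close> costs \<open>\<epsilon>\<close> again.
    So \<open>a < (1 - c) * a + 2 * \<epsilon>\<close>.\<close>
  have "norm (prob (A n \<inter> E \<inter> space P) - 0) < r" if n: "n \<ge> max m n0" for n
  proof -
    have An: "A n \<inter> space P \<in> sets P" using determined_by_measurable[OF J(1,2) A] .
    have Jmn: "J m \<subseteq> J n" using n J(3) by (simp add: incseqD)
    have det: "determined_by (J n) (A n \<inter> D)"
      by (rule determined_by_Int[OF A determined_by_mono[OF D(1) Jmn]])
    have m1: "A n \<inter> D \<inter> E \<inter> space P \<in> sets P" "A n \<inter> E \<inter> space P \<in> sets P" "A n \<inter> D \<inter> space P \<in> sets P"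
    proof -
      have "A n \<inter> D \<inter> E \<inter> space P = (A n \<inter> space P) \<inter> (D \<inter> space P) \<inter> (E \<inter> space P)"
        "A n \<inter> E \<inter> space P = (A n \<inter> space P) \<inter> (E \<inter> space P)"
        "A n \<inter> D \<inter> space P = (A n \<inter> space P) \<inter> (D \<inter> space P)" by blast+
      then show "A n \<inter> D \<inter> E \<inter> space P \<in> sets P" "A n \<inter> E \<inter> space P \<in> sets P" "A n \<inter> D \<inter> space P \<in> sets P"
        using An E Dm by (metis sets.Int)+
    qed
    have "prob (A n \<inter> E \<inter> space P) \<le> prob ((A n \<inter> D \<inter> E \<inter> space P) \<union> ?S)"
      by (rule finite_measure_mono) (use m1 Sm in auto)
    also have "\<dots> \<le> prob (A n \<inter> D \<inter> E \<inter> space P) + prob ?S"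
      using m1 Sm by (intro measure_Un_le)
    finally have 1: "prob (A n \<inter> E \<inter> space P) \<le> prob (A n \<inter> D \<inter> E \<inter> space P) + prob ?S" .
    have 2: "prob (A n \<inter> D \<inter> E \<inter> space P) \<le> (1 - c) * prob (A n \<inter> D \<inter> space P)"
      by (rule le[OF _ det]) (use n in auto)
    have 3: "(1 - c) * prob (A n \<inter> D \<inter> space P) \<le> (1 - c) * prob (A n \<inter> E \<inter> space P) + \<epsilon>"
    proof -
      have "prob (A n \<inter> D \<inter> space P) \<le> prob ((A n \<inter> E \<inter> space P) \<union> ?S)"
        by (rule finite_measure_mono) (use m1 Sm in auto)
      also have "\<dots> \<le> prob (A n \<inter> E \<inter> space P) + prob ?S"
        using m1 Sm by (intro measure_Un_le)
      finally have "(1 - c) * prob (A n \<inter> D \<inter> space P) \<le> (1 - c) * (prob (A n \<inter> E \<inter> space P) + prob ?S)"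
        using c by (intro mult_left_mono) auto
      also have "\<dots> = (1 - c) * prob (A n \<inter> E \<inter> space P) + (1 - c) * prob ?S" by (simp add: algebra_simps)
      also have "(1 - c) * prob ?S \<le> 1 * prob ?S" using c by (intro mult_right_mono) auto
      finally show ?thesis using D(2) by linarith
    qed
    have "prob (A n \<inter> E \<inter> space P) < (1 - c) * prob (A n \<inter> E \<inter> space P) + 2 * \<epsilon>"
      using 1 2 3 D(2) by linarith
    then have "c * prob (A n \<inter> E \<inter> space P) < 2 * \<epsilon>" by (simp add: left_diff_distrib)
    then have "prob (A n \<inter> E \<inter> space P) < r" using c by (simp add: \<epsilon>_def)
    then show ?thesis by simp
  qed
  then show "\<exists>no. \<forall>n\<ge>no. norm (prob (A n \<inter> E \<inter> space P) - 0) < r" by blast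
qed

text \<open>Continuity from above extends the finite product formula to infinitely many edges, as
  needed for all edges leaving a ball.\<close>

lemma prob_all_closed_UN_ge:
  assumes J: "\<And>m. finite (J m)" "\<And>m. J m \<subseteq> I" "incseq J" and ge: "\<And>m. c \<le> (\<Prod>i\<in>J m. 1 - p i)"
  shows "{\<omega>\<in>space P. \<forall>i\<in>\<Union>m. J m. \<not> \<omega> i} \<in> sets P"
    and "c \<le> prob {\<omega>\<in>space P. \<forall>i\<in>\<Union>m. J m. \<not> \<omega> i}"
proof -
  let ?A = "\<lambda>m. {\<omega>\<in>space P. \<forall>i\<in>J m. \<not> \<omega> i}"
  have A: "?A m \<in> sets P" for m
    using atom_measurable[OF J(1,2), of m "\<lambda>_. False"] by simp
  have eq: "{\<omega>\<in>space P. \<forall>i\<in>\<Union>m. J m. \<not> \<omega> i} = (\<Inter>m. ?A m)" by auto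
  show "{\<omega>\<in>space P. \<forall>i\<in>\<Union>m. J m. \<not> \<omega> i} \<in> sets P"
    unfolding eq using A by (intro sets.countable_INT) auto
  have "(\<lambda>m. prob (?A m)) \<longlonglongrightarrow> prob (\<Inter>m. ?A m)"
  proof (rule finite_Lim_measure_decseq)
    show "range ?A \<subseteq> sets P" using A by blast
    show "decseq ?A" unfolding decseq_def using incseqD[OF J(3)] by blast
  qed
  then show "c \<le> prob {\<omega>\<in>space P. \<forall>i\<in>\<Union>m. J m. \<not> \<omega> i}"
    unfolding eq by (rule LIMSEQ_le_const) (use ge prob_all_closed[OF J(1,2)] in auto)
qed

text \<open>Permuting coordinates with equal parameters preserves the product law. Later the
  permutation of edges is induced by an isometry of the lattice.\<close>

lemma prob_reindex:
  assumes f: "bij_betw f I I" "\<And>i. i \<in> I \<Longrightarrow> p (f i) = p i" and A: "A \<in> sets P"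
  shows "prob {\<omega>\<in>space P. (\<lambda>i\<in>I. \<omega> (f i)) \<in> A} = prob A"
proof -
  let ?M = "\<lambda>i. measure_pmf (bernoulli_pmf (p i))"
  have fI: "f \<in> I \<rightarrow> I" "inj_on f I" using f(1) by (auto simp: bij_betw_def)
  have eq: "(\<Pi>\<^sub>M i\<in>I. ?M (f i)) = P"
    unfolding P_def using f(2) by (intro PiM_cong) auto
  have "distr P P (\<lambda>\<omega>. \<lambda>i\<in>I. \<omega> (f i)) = P"
    using distr_PiM_reindex[of I ?M f I] fI measure_pmf.prob_space_axioms
    unfolding eq P_def[symmetric] by blast
  then have "prob A = measure (distr P P (\<lambda>\<omega>. \<lambda>i\<in>I. \<omega> (f i))) A" by simp
  also have "\<dots> = prob ((\<lambda>\<omega>. \<lambda>i\<in>I. \<omega> (f i)) -` A \<inter> space P)"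
  proof (rule measure_distr[OF _ A])
    show "(\<lambda>\<omega>. \<lambda>i\<in>I. \<omega> (f i)) \<in> P \<rightarrow>\<^sub>M P"
    proof (subst (2) P_def, rule measurable_restrict)
      fix i assume "i \<in> I"
      then have "f i \<in> I" using fI by blast
      from component_measurable[OF this]
      show "(\<lambda>\<omega>. \<omega> (f i)) \<in> P \<rightarrow>\<^sub>M ?M i" by simp
    qed
  qed
  also have "(\<lambda>\<omega>. \<lambda>i\<in>I. \<omega> (f i)) -` A \<inter> space P = {\<omega>\<in>space P. (\<lambda>i\<in>I. \<omega> (f i)) \<in> A}" by blast
  finally show ?thesis ..
qed

end

text \<open>A reverse Markov inequality: the expected number of events that occur is at least
  \<open>2 * q * card V\<close>, while the number is at most \<open>card V\<close> on the event in
  question and at most \<open>q * card V\<close> off it.\<close>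

lemma (in prob_space) prob_many_events_ge:
  assumes V: "finite V" "V \<noteq> {}" and A: "\<And>x. x \<in> V \<Longrightarrow> A x \<in> events" "\<And>x. x \<in> V \<Longrightarrow> 2 * q \<le> prob (A x)"
    and Z: "{\<omega>\<in>space M. q * real (card V) \<le> real (card {x\<in>V. \<omega> \<in> A x})} \<in> events" and q: "0 \<le> q"
  shows "q \<le> prob {\<omega>\<in>space M. q * real (card V) \<le> real (card {x\<in>V. \<omega> \<in> A x})}" (is "_ \<le> prob ?Z")
proof -
  have cnt: "real (card {x\<in>V. \<omega> \<in> A x}) = (\<Sum>x\<in>V. indicator (A x) \<omega>)" for \<omega>
    using V by (simp add: indicator_def sum.If_cases Int_def)
  have "2 * q * real (card V) \<le> (\<Sum>x\<in>V. prob (A x))"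
    using sum_mono[of V "\<lambda>_. 2 * q" "\<lambda>x. prob (A x)"] A(2) by (simp add: mult.commute)
  also have "\<dots> = (\<integral>\<omega>. (\<Sum>x\<in>V. indicator (A x) \<omega>) \<partial>M)"
    using A by (subst Bochner_Integration.integral_sum) (auto simp: emeasure_eq_measure)
  also have "\<dots> \<le> (\<integral>\<omega>. real (card V) * indicator ?Z \<omega> + q * real (card V) \<partial>M)"
  proof (rule integral_mono)
    show "integrable M (\<lambda>\<omega>. \<Sum>x\<in>V. indicator (A x) \<omega> :: real)"
      using A by (intro Bochner_Integration.integrable_sum) (auto simp: emeasure_eq_measure)
    show "integrable M (\<lambda>\<omega>. real (card V) * indicator ?Z \<omega> + q * real (card V))"
      using Z by (intro Bochner_Integration.integrable_add integrable_mult_right) (auto simp: emeasure_eq_measure)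
    fix \<omega> assume w: "\<omega> \<in> space M"
    have "card {x\<in>V. \<omega> \<in> A x} \<le> card V" using V by (intro card_mono) auto
    then show "(\<Sum>x\<in>V. indicator (A x) \<omega>) \<le> real (card V) * indicator ?Z \<omega> + q * real (card V)"
      unfolding cnt[symmetric] using w q by (auto simp: indicator_def add_increasing2)
  qed
  also have "\<dots> = real (card V) * prob ?Z + q * real (card V)"
    using Z by (subst Bochner_Integration.integral_add) (auto simp: emeasure_eq_measure prob_space)
  finally have "q * real (card V) \<le> prob ?Z * real (card V)" by (simp add: algebra_simps)
  then show ?thesis using V by (simp add: card_gt_0_iff)
qed


section \<open>Balls, symmetries and local clusters\<close>

text \<open>The ball of radius \<open>n\<close> around the origin: \<open>hdist\<close> adds 1 to
  the index, so distance at most \<open>n\<close> means that the coordinates from index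
  \<open>n\<close> on vanish.\<close>

definition hball :: "nat \<Rightarrow> nat \<Rightarrow> (nat \<Rightarrow> nat) set" where
  "hball N n = {x \<in> hlattice N. \<forall>i\<ge>n. x i = 0}"

text \<open>One of the other balls of radius \<open>n\<close> inside \<open>hball N (Suc n)\<close>,
  namely the one whose digit at index \<open>n\<close> is 1. All its points are at distance
  \<open>Suc n\<close> from all points of \<open>hball N n\<close>.\<close>

definition sibling :: "nat \<Rightarrow> nat \<Rightarrow> (nat \<Rightarrow> nat) set" where
  "sibling N n = {x \<in> hlattice N. x n = 1 \<and> (\<forall>i>n. x i = 0)}"

lemma hlattice_iff: "x \<in> hlattice N \<longleftrightarrow> (\<forall>i. x i < N) \<and> finite {i. x i \<noteq> 0}"
  by (simp add: hlattice_def summable_nat_iff_finite_support)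

lemma hball_subset: "hball N n \<subseteq> hlattice N"
  by (auto simp: hball_def)

lemma hball_mono: "m \<le> n \<Longrightarrow> hball N m \<subseteq> hball N n"
  by (auto simp: hball_def)

lemma UN_hball: "(\<Union>n. hball N n) = hlattice N"
proof
  show "(\<Union>n. hball N n) \<subseteq> hlattice N" by (auto simp: hball_def)
  show "hlattice N \<subseteq> (\<Union>n. hball N n)"
  proof
    fix x assume x: "x \<in> hlattice N"
    then have "finite {i. x i \<noteq> 0}" by (simp add: hlattice_iff)
    then obtain n where "\<forall>i\<in>{i. x i \<noteq> 0}. i < n" using finite_nat_set_iff_bounded by blast
    then have "x \<in> hball N n" using x by (force simp: hball_def)
    then show "x \<in> (\<Union>n. hball N n)" by blast
  qed
qed

lemma sibling_subset: "sibling N n \<subseteq> hball N (Suc n) - hball N n"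
  by (auto simp: hball_def sibling_def)

lemma bij_betw_hball:
  assumes "0 < N"
  shows "bij_betw (\<lambda>f i. if i < n then f i else 0) ({..<n} \<rightarrow>\<^sub>E {..<N}) (hball N n)"
proof (rule bij_betw_byWitness[where f' = "\<lambda>x. restrict x {..<n}"])
  show "\<forall>a\<in>{..<n} \<rightarrow>\<^sub>E {..<N}. restrict (\<lambda>i. if i < n then a i else 0) {..<n} = a"
    by (auto simp: fun_eq_iff PiE_iff extensional_def)
  show "\<forall>a'\<in>hball N n. (\<lambda>i. if i < n then restrict a' {..<n} i else 0) = a'"
    by (auto simp: fun_eq_iff hball_def)
  show "(\<lambda>f i. if i < n then f i else 0) ` ({..<n} \<rightarrow>\<^sub>E {..<N}) \<subseteq> hball N n"
  proof (rule image_subsetI)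
    fix f assume f: "f \<in> {..<n} \<rightarrow>\<^sub>E {..<N}"
    have "finite {i. (if i < n then f i else 0) \<noteq> 0}"
      by (rule finite_subset[of _ "{..<n}"]) (auto split: if_splits)
    then show "(\<lambda>i. if i < n then f i else 0) \<in> hball N n"
      using f assms by (auto simp: hball_def hlattice_iff PiE_iff)
  qed
  show "(\<lambda>x. restrict x {..<n}) ` hball N n \<subseteq> {..<n} \<rightarrow>\<^sub>E {..<N}"
    by (rule image_subsetI) (simp add: restrict_PiE_iff hball_def hlattice_iff)
qed

lemma finite_hball: "finite (hball N n)"
proof (cases "N = 0")
  case True
  then show ?thesis by (simp add: hball_def hlattice_iff)
next
  case False
  then have "finite ({..<n} \<rightarrow>\<^sub>E {..<N}) \<longleftrightarrow> finite (hball N n)"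
    using bij_betw_finite[OF bij_betw_hball[of N n]] by blast
  then show ?thesis by (simp add: finite_PiE)
qed

lemma card_hball: "0 < N \<Longrightarrow> card (hball N n) = N ^ n"
  using bij_betw_same_card[OF bij_betw_hball[of N n]] by (simp add: card_PiE)

lemma countable_hlattice: "countable (hlattice N)"
  unfolding UN_hball[symmetric] by (intro countable_UN) (auto intro: countable_finite finite_hball)

text \<open>The point of the shell has a nonzero digit at index \<open>k\<close> and none beyond,
  while the point of the ball has digit 0 from \<open>k\<close> on. Thus all edges from a ball to a
  given shell have the same probability.\<close>

lemma hdist_eq_Suc:
  assumes "u \<in> hball N k" "v \<in> hball N (Suc k) - hball N k"
  shows "hdist u v = Suc k"
proof -
  have vk: "v k \<noteq> 0"
  proof
    assume "v k = 0"
    then have "v i = 0" if "i \<ge> k" for i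
      using assms(2) that by (cases "i = k") (auto simp: hball_def)
    then show False using assms(2) by (auto simp: hball_def)
  qed
  have uk: "u i = 0" if "i \<ge> k" for i using assms(1) that by (auto simp: hball_def)
  have vs: "v i = 0" if "i \<ge> Suc k" for i using assms(2) that by (auto simp: hball_def)
  have "u k \<noteq> v k" using vk uk by simp
  then have "u \<noteq> v" by auto
  have le: "i \<le> k" if "u i \<noteq> v i" for i
    using that uk[of i] vs[of i] by (cases "i \<ge> Suc k") auto
  have "Max {Suc i |i. u i \<noteq> v i} = Suc k"
  proof (rule Max_eqI)
    show "finite {Suc i |i. u i \<noteq> v i}"
      by (rule finite_subset[of _ "{..Suc k}"]) (use le in auto)
    show "y \<le> Suc k" if "y \<in> {Suc i |i. u i \<noteq> v i}" for y using le that by auto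
    show "Suc k \<in> {Suc i |i. u i \<noteq> v i}" using \<open>u k \<noteq> v k\<close> by blast
  qed
  then show ?thesis using \<open>u \<noteq> v\<close> by (simp add: hdist_def)
qed

text \<open>Coordinatewise transposition is an isometry that exchanges \<open>a\<close> and
  \<open>b\<close> and witnesses transitivity. Being an involution, it needs no separate inverse, in
  contrast to addition modulo \<open>N\<close>.\<close>

definition swap_map :: "(nat \<Rightarrow> nat) \<Rightarrow> (nat \<Rightarrow> nat) \<Rightarrow> (nat \<Rightarrow> nat) \<Rightarrow> nat \<Rightarrow> nat" where
  "swap_map a b v = (\<lambda>i. Transposition.transpose (a i) (b i) (v i))"

lemma swap_map_involutory [simp]: "swap_map a b (swap_map a b v) = v"
  by (simp add: swap_map_def)

lemma swap_map_left [simp]: "swap_map a b a = b"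
  by (simp add: swap_map_def)

lemma swap_map_eq_iff [simp]: "swap_map a b u = swap_map a b v \<longleftrightarrow> u = v"
  by (metis swap_map_involutory)

lemma swap_map_hlattice:
  assumes "a \<in> hlattice N" "b \<in> hlattice N" "v \<in> hlattice N"
  shows "swap_map a b v \<in> hlattice N"
proof -
  have "{i. swap_map a b v i \<noteq> 0} \<subseteq> {i. a i \<noteq> 0} \<union> {i. b i \<noteq> 0} \<union> {i. v i \<noteq> 0}"
    by (auto simp: swap_map_def Transposition.transpose_def)
  then have "finite {i. swap_map a b v i \<noteq> 0}"
    using assms by (auto simp: hlattice_iff intro: finite_subset)
  then show ?thesis using assms by (auto simp: hlattice_iff swap_map_def Transposition.transpose_def)
qed

lemma hdist_swap_map [simp]: "hdist (swap_map a b u) (swap_map a b v) = hdist u v"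
proof -
  have "swap_map a b u i \<noteq> swap_map a b v i \<longleftrightarrow> u i \<noteq> v i" for i
    unfolding swap_map_def by (metis transpose_involutory)
  then show ?thesis by (simp add: hdist_def)
qed

lemma swap_map_image_hball:
  assumes "a \<in> hball N n" "b \<in> hball N n"
  shows "swap_map a b ` hball N n = hball N n"
proof -
  have sub: "swap_map a b ` hball N n \<subseteq> hball N n"
    using assms swap_map_hlattice[of a N b] by (auto simp: hball_def swap_map_def)
  moreover have "hball N n \<subseteq> swap_map a b ` hball N n"
    using sub by (metis image_subset_iff swap_map_involutory image_eqI subsetI)
  ultimately show ?thesis by blast
qed

text \<open>The map exchanges the digits 0 and 1 at index \<open>n\<close> and fixes all other
  coordinates, so it interchanges the ball and its sibling.\<close>

lemma swap_map_image_sibling: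
  fixes N n :: nat
  assumes "2 \<le> N"
  defines "b \<equiv> (\<lambda>i. if i = n then 1 else 0)"
  shows "(\<lambda>_. 0) \<in> hlattice N" "b \<in> hlattice N" "swap_map (\<lambda>_. 0) b ` hball N n = sibling N n"
proof -
  show z: "(\<lambda>_. 0) \<in> hlattice N" and b: "b \<in> hlattice N"
    using assms by (auto simp: hlattice_iff b_def)
  have 1: "swap_map (\<lambda>_. 0) b v \<in> sibling N n" if "v \<in> hball N n" for v
    using that swap_map_hlattice[OF z b, of v] by (auto simp: hball_def sibling_def swap_map_def b_def)
  have 2: "swap_map (\<lambda>_. 0) b v \<in> hball N n" if "v \<in> sibling N n" for v
    using that swap_map_hlattice[OF z b, of v] by (auto simp: hball_def sibling_def swap_map_def b_def)
  show "swap_map (\<lambda>_. 0) b ` hball N n = sibling N n"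
  proof
    show "swap_map (\<lambda>_. 0) b ` hball N n \<subseteq> sibling N n" using 1 by blast
    show "sibling N n \<subseteq> swap_map (\<lambda>_. 0) b ` hball N n"
    proof
      fix v assume "v \<in> sibling N n"
      from imageI[OF 2[OF this], of "swap_map (\<lambda>_. 0) b"]
      show "v \<in> swap_map (\<lambda>_. 0) b ` hball N n" by simp
    qed
  qed
qed

section \<open>Edge sets and clusters inside a vertex set\<close>

definition edges_in :: "nat \<Rightarrow> (nat \<Rightarrow> nat) set \<Rightarrow> (nat \<Rightarrow> nat) set set" where
  "edges_in N V = {e \<in> hedges N. e \<subseteq> V}"

definition edges_between :: "(nat \<Rightarrow> nat) set \<Rightarrow> (nat \<Rightarrow> nat) set \<Rightarrow> (nat \<Rightarrow> nat) set set" where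
  "edges_between S T = {{u, v} |u v. u \<in> S \<and> v \<in> T}"

text \<open>Only paths that stay in \<open>V\<close> count. For \<open>x\<close> outside
  \<open>V\<close> the value is \<open>{x}\<close>, and \<open>V = UNIV\<close> gives the full
  cluster.\<close>

definition local_cluster ::
  "nat \<Rightarrow> (nat \<Rightarrow> nat) set \<Rightarrow> ((nat \<Rightarrow> nat) set \<Rightarrow> bool) \<Rightarrow> (nat \<Rightarrow> nat) \<Rightarrow> (nat \<Rightarrow> nat) set" where
  "local_cluster N V \<omega> x = {y. (\<lambda>u v. u \<in> V \<and> v \<in> V \<and> adjacent N \<omega> u v)\<^sup>*\<^sup>* x y}"

lemma doubleton_in_hedges: "{u, v} \<in> hedges N \<longleftrightarrow> u \<in> hlattice N \<and> v \<in> hlattice N \<and> u \<noteq> v"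
  by (auto simp: hedges_def doubleton_eq_iff)

lemma adjacent_commute: "adjacent N \<omega> u v \<longleftrightarrow> adjacent N \<omega> v u"
  by (simp add: adjacent_def insert_commute)

lemma edges_in_subset: "edges_in N V \<subseteq> hedges N"
  by (auto simp: edges_in_def)

lemma edges_in_mono: "V \<subseteq> W \<Longrightarrow> edges_in N V \<subseteq> edges_in N W"
  by (auto simp: edges_in_def)

lemma finite_edges_in: "finite V \<Longrightarrow> finite (edges_in N V)"
  by (rule finite_subset[of _ "Pow V"]) (auto simp: edges_in_def)

lemma UN_edges_in: "(\<Union>n. edges_in N (hball N n)) = hedges N"
proof
  show "(\<Union>n. edges_in N (hball N n)) \<subseteq> hedges N" by (auto simp: edges_in_def)
  show "hedges N \<subseteq> (\<Union>n. edges_in N (hball N n))"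
  proof
    fix e assume e: "e \<in> hedges N"
    then obtain x y where xy: "e = {x, y}" "x \<in> hlattice N" "y \<in> hlattice N" by (auto simp: hedges_def)
    then obtain m n where mn: "x \<in> hball N m" "y \<in> hball N n" unfolding UN_hball[symmetric] by blast
    have "e \<subseteq> hball N (max m n)" using xy mn hball_mono[of m "max m n" N] hball_mono[of n "max m n" N] by auto
    then show "e \<in> (\<Union>n. edges_in N (hball N n))" using e by (auto simp: edges_in_def)
  qed
qed

lemma countable_hedges: "countable (hedges N)"
  unfolding UN_edges_in[symmetric]
  by (intro countable_UN) (auto intro: countable_finite finite_edges_in finite_hball)

lemma edges_between_subset:
  "S \<subseteq> hlattice N \<Longrightarrow> T \<subseteq> hlattice N \<Longrightarrow> S \<inter> T = {} \<Longrightarrow> edges_between S T \<subseteq> hedges N"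
  by (auto simp: edges_between_def hedges_def) blast

lemma finite_edges_between: "finite S \<Longrightarrow> finite T \<Longrightarrow> finite (edges_between S T)"
  unfolding edges_between_def using finite_image_set2[of "\<lambda>u. u \<in> S" "\<lambda>v. v \<in> T"] by simp

lemma inj_on_edges_between: "S \<inter> T = {} \<Longrightarrow> inj_on (\<lambda>(u, v). {u, v}) (S \<times> T)"
  by (auto simp: inj_on_def doubleton_eq_iff)

lemma edges_between_eq_image: "edges_between S T = (\<lambda>(u, v). {u, v}) ` (S \<times> T)"
  by (auto simp: edges_between_def)

lemma self_in_local_cluster [simp]: "x \<in> local_cluster N V \<omega> x"
  by (simp add: local_cluster_def)

lemma local_cluster_subset:
  assumes "x \<in> V" shows "local_cluster N V \<omega> x \<subseteq> V"
proof
  fix y assume "y \<in> local_cluster N V \<omega> x"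
  then have "(\<lambda>u v. u \<in> V \<and> v \<in> V \<and> adjacent N \<omega> u v)\<^sup>*\<^sup>* x y" by (simp add: local_cluster_def)
  then show "y \<in> V" using assms by (induction rule: rtranclp_induct) auto
qed

lemma local_cluster_mono: "V \<subseteq> W \<Longrightarrow> local_cluster N V \<omega> x \<subseteq> local_cluster N W \<omega> x"
  unfolding local_cluster_def by (auto elim!: rtranclp_mono[THEN predicate2D, rotated])

lemma local_cluster_step:
  assumes "u \<in> local_cluster N V \<omega> x" "u \<in> V" "v \<in> V" "adjacent N \<omega> u v"
  shows "v \<in> local_cluster N V \<omega> x"
  using assms unfolding local_cluster_def by (auto intro: rtranclp.rtrancl_into_rtrancl)

lemma local_cluster_eqI:
  assumes "y \<in> local_cluster N V \<omega> x"
  shows "local_cluster N V \<omega> y = local_cluster N V \<omega> x"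
proof -
  let ?R = "\<lambda>u v. u \<in> V \<and> v \<in> V \<and> adjacent N \<omega> u v"
  have sym: "symp ?R" by (auto simp: symp_def adjacent_commute)
  have xy: "?R\<^sup>*\<^sup>* x y" using assms by (simp add: local_cluster_def)
  then have yx: "?R\<^sup>*\<^sup>* y x" using symp_rtranclp[OF sym] by (auto simp: symp_def)
  show ?thesis unfolding local_cluster_def using xy yx by (auto intro: rtranclp_trans)
qed

lemma cluster_eq_local: "cluster N \<omega> x = local_cluster N UNIV \<omega> x"
  by (simp add: cluster_def local_cluster_def)

lemma cluster_eqI: "y \<in> cluster N \<omega> x \<Longrightarrow> cluster N \<omega> y = cluster N \<omega> x"
  unfolding cluster_eq_local by (rule local_cluster_eqI)

lemma local_cluster_subset_cluster: "local_cluster N V \<omega> x \<subseteq> cluster N \<omega> x"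
  unfolding cluster_eq_local by (rule local_cluster_mono) simp

lemma local_cluster_cong:
  assumes "\<And>e. e \<in> edges_in N V \<Longrightarrow> \<omega> e = \<omega>' e"
  shows "local_cluster N V \<omega> x = local_cluster N V \<omega>' x"
proof -
  have "(u \<in> V \<and> v \<in> V \<and> adjacent N \<omega> u v) \<longleftrightarrow> (u \<in> V \<and> v \<in> V \<and> adjacent N \<omega>' u v)" for u v
    using assms[of "{u, v}"] by (auto simp: adjacent_def edges_in_def)
  then show ?thesis by (simp add: local_cluster_def)
qed

text \<open>\<open>Q\<close> is applied to the whole function that sends a vertex to its local
  cluster, so that size thresholds, counts of vertices and existence of giant clusters are all
  instances.\<close>

lemma determined_by_local_cluster:
  "determined_by (edges_in N V) {\<omega>. Q (local_cluster N V \<omega>)}"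
  unfolding determined_by_def
proof (intro allI impI)
  fix \<omega> \<omega>' :: "(nat \<Rightarrow> nat) set \<Rightarrow> bool"
  assume "\<forall>i\<in>edges_in N V. \<omega> i = \<omega>' i"
  then have "local_cluster N V \<omega> = local_cluster N V \<omega>'"
    by (intro ext local_cluster_cong) auto
  then show "\<omega> \<in> {\<omega>. Q (local_cluster N V \<omega>)} \<longleftrightarrow> \<omega>' \<in> {\<omega>. Q (local_cluster N V \<omega>)}" by simp
qed

lemma incseq_local_cluster: "incseq (\<lambda>n. local_cluster N (hball N n) \<omega> x)"
  by (intro incseq_SucI local_cluster_mono hball_mono) simp

text \<open>A finite path visits finitely many vertices and so stays in some ball.\<close>

lemma cluster_eq_UN: "cluster N \<omega> x = (\<Union>n. local_cluster N (hball N n) \<omega> x)"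
proof
  show "(\<Union>n. local_cluster N (hball N n) \<omega> x) \<subseteq> cluster N \<omega> x"
    using local_cluster_subset_cluster by blast
  show "cluster N \<omega> x \<subseteq> (\<Union>n. local_cluster N (hball N n) \<omega> x)"
  proof
    fix y assume "y \<in> cluster N \<omega> x"
    then have "(adjacent N \<omega>)\<^sup>*\<^sup>* x y" by (simp add: cluster_def)
    then show "y \<in> (\<Union>n. local_cluster N (hball N n) \<omega> x)"
    proof (induction rule: rtranclp_induct)
      case base
      then show ?case by simp
    next
      case (step y z)
      then obtain n where n: "y \<in> local_cluster N (hball N n) \<omega> x" by blast
      have "y \<in> hlattice N" "z \<in> hlattice N"
        using step(2) by (auto simp: adjacent_def doubleton_in_hedges)
      then obtain k l where kl: "y \<in> hball N k" "z \<in> hball N l" unfolding UN_hball[symmetric] by blast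
      define m where "m = max n (max k l)"
      have "y \<in> local_cluster N (hball N m) \<omega> x"
        using n local_cluster_mono[OF hball_mono[of n m N]] by (auto simp: m_def)
      moreover have "y \<in> hball N m" "z \<in> hball N m"
        using kl hball_mono[of k m N] hball_mono[of l m N] unfolding m_def by (simp_all add: subset_iff)
      ultimately have "z \<in> local_cluster N (hball N m) \<omega> x"
        using step(2) by (rule local_cluster_step)
      then show ?case by blast
    qed
  qed
qed

text \<open>A path cannot leave the ball without using an open edge out of the local cluster. Read
  contrapositively, an infinite cluster forces such an edge.\<close>

lemma cluster_eq_local_cluster:
  assumes x: "x \<in> hball N n"
    and closed: "\<And>u v. u \<in> local_cluster N (hball N n) \<omega> x \<Longrightarrow> v \<in> hlattice N - hball N n \<Longrightarrow> \<not> \<omega> {u, v}"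
  shows "cluster N \<omega> x = local_cluster N (hball N n) \<omega> x"
proof
  show "cluster N \<omega> x \<subseteq> local_cluster N (hball N n) \<omega> x"
  proof
    fix y assume "y \<in> cluster N \<omega> x"
    then have "(adjacent N \<omega>)\<^sup>*\<^sup>* x y" by (simp add: cluster_def)
    then show "y \<in> local_cluster N (hball N n) \<omega> x"
    proof (induction rule: rtranclp_induct)
      case base
      then show ?case by simp
    next
      case (step y z)
      have z: "z \<in> hlattice N" "\<omega> {y, z}"
        using step(2) by (auto simp: adjacent_def doubleton_in_hedges)
      then have "z \<in> hball N n" using closed step(3) by blast
      moreover have "y \<in> hball N n" using local_cluster_subset[OF x] step(3) by blast
      ultimately show ?case using local_cluster_step step by metis
    qed
  qed
qed (rule local_cluster_subset_cluster)

text \<open>The configuration pulled back along a vertex map. Restricting to \<open>hedges N\<close>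
  keeps it in the product space.\<close>

definition move_edges ::
  "nat \<Rightarrow> ((nat \<Rightarrow> nat) \<Rightarrow> nat \<Rightarrow> nat) \<Rightarrow> ((nat \<Rightarrow> nat) set \<Rightarrow> bool) \<Rightarrow> (nat \<Rightarrow> nat) set \<Rightarrow> bool" where
  "move_edges N T \<omega> = (\<lambda>e\<in>hedges N. \<omega> (T ` e))"

lemma local_cluster_move_edges:
  assumes T: "\<And>v. T (T v) = v" "\<And>v. v \<in> hlattice N \<Longrightarrow> T v \<in> hlattice N"
  shows "local_cluster N (T ` V) \<omega> (T x) = T ` local_cluster N V (move_edges N T \<omega>) x"
proof -
  have inj: "T u = T v \<longleftrightarrow> u = v" for u v using T(1) by metis
  have lat: "T v \<in> hlattice N \<longleftrightarrow> v \<in> hlattice N" for v using T by metis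
  have im: "T u \<in> T ` W \<longleftrightarrow> u \<in> W" for u W by (simp add: image_iff inj)
  have adj: "adjacent N \<omega> (T u) (T v) \<longleftrightarrow> adjacent N (move_edges N T \<omega>) u v" for u v
    by (auto simp: adjacent_def move_edges_def doubleton_in_hedges lat inj)
  let ?R = "\<lambda>u v. u \<in> T ` V \<and> v \<in> T ` V \<and> adjacent N \<omega> u v"
  let ?S = "\<lambda>u v. u \<in> V \<and> v \<in> V \<and> adjacent N (move_edges N T \<omega>) u v"
  have RS: "?R (T u) (T v) \<longleftrightarrow> ?S u v" for u v by (simp add: im adj)
  have 1: "?R\<^sup>*\<^sup>* (T x) (T y)" if "?S\<^sup>*\<^sup>* x y" for y
    using that by (induction rule: rtranclp_induct) (use RS in \<open>auto intro: rtranclp.rtrancl_into_rtrancl\<close>)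
  have 2: "?S\<^sup>*\<^sup>* x (T y)" if "?R\<^sup>*\<^sup>* (T x) y" for y
    using that
  proof (induction rule: rtranclp_induct)
    case base
    then show ?case by (simp add: T)
  next
    case (step y z)
    have "?S (T y) (T z)" using step(2) RS[of "T y" "T z"] by (simp add: T)
    then show ?case using step(3) by (auto intro: rtranclp.rtrancl_into_rtrancl)
  qed
  show ?thesis
    unfolding local_cluster_def
  proof (intro set_eqI iffI)
    fix y assume "y \<in> {y. ?R\<^sup>*\<^sup>* (T x) y}"
    then have "T y \<in> {y. ?S\<^sup>*\<^sup>* x y}" using 2 by blast
    then have "T (T y) \<in> T ` {y. ?S\<^sup>*\<^sup>* x y}" by (rule imageI)
    then show "y \<in> T ` {y. ?S\<^sup>*\<^sup>* x y}" by (simp only: T(1))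
  qed (use 1 in blast)
qed

text \<open>Take a subset of least cardinality whose sum reaches a third of the total. Removing one
  element drops the sum below a third, and that element itself weighs less than a third.\<close>

lemma subset_sum_middle_third:
  fixes w :: "'b \<Rightarrow> real"
  assumes "finite D" "\<And>d. d \<in> D \<Longrightarrow> 0 \<le> w d" "\<And>d. d \<in> D \<Longrightarrow> w d < sum w D / 3"
  obtains D' where "D' \<subseteq> D" "sum w D / 3 \<le> sum w D'" "sum w D' \<le> 2 * sum w D / 3"
proof -
  let ?Q = "\<lambda>D'. D' \<subseteq> D \<and> sum w D / 3 \<le> sum w D'"
  have nn: "0 \<le> sum w D" using assms by (intro sum_nonneg)
  then have "?Q D" by auto
  then obtain D' where D': "?Q D'" and min: "\<And>X. ?Q X \<Longrightarrow> card D' \<le> card X"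
    using ex_has_least_nat[of ?Q D card] by blast
  have fin: "finite D'" using D' assms(1) by (auto intro: finite_subset)
  have "sum w D' \<le> 2 * sum w D / 3"
  proof (cases "D' = {}")
    case True
    then show ?thesis using nn by simp
  next
    case False
    then obtain d where d: "d \<in> D'" by blast
    then have "card (D' - {d}) < card D'" using fin by (intro card_Diff1_less)
    then have "\<not> ?Q (D' - {d})" using min by (meson not_le)
    then have "sum w (D' - {d}) < sum w D / 3" using D' by auto
    moreover have "sum w D' = w d + sum w (D' - {d})" using fin d by (rule sum.remove)
    moreover have "w d < sum w D / 3" using assms(3) D' d by blast
    ultimately show ?thesis by simp
  qed
  then show thesis using D' that by blast
qed


section \<open>Local clusters of vertices in infinite clusters are large\<close>

lemma finite_local_cluster: "finite V \<Longrightarrow> finite (local_cluster N V \<omega> x)"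
proof (rule finite_subset)
  show "local_cluster N V \<omega> x \<subseteq> insert x V"
  proof
    fix y assume "y \<in> local_cluster N V \<omega> x"
    then have "(\<lambda>u v. u \<in> V \<and> v \<in> V \<and> adjacent N \<omega> u v)\<^sup>*\<^sup>* x y" by (simp add: local_cluster_def)
    then show "y \<in> insert x V" by (induction rule: rtranclp_induct) auto
  qed
qed simp

text \<open>Finitely many vertices of a cluster already lie in the local cluster of one ball. This
  expresses infinitude by countably many local events, hence measurably.\<close>

lemma infinite_cluster_iff:
  "infinite (cluster N \<omega> x) \<longleftrightarrow> (\<forall>k. \<exists>n. k \<le> card (local_cluster N (hball N n) \<omega> x))"
proof
  assume inf: "infinite (cluster N \<omega> x)"
  show "\<forall>k. \<exists>n. k \<le> card (local_cluster N (hball N n) \<omega> x)"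
  proof
    fix k
    obtain F where F: "F \<subseteq> cluster N \<omega> x" "card F = k" "finite F"
      using infinite_arbitrarily_large[OF inf] by blast
    have "F \<subseteq> (\<Union>n. local_cluster N (hball N n) \<omega> x)" using F(1) cluster_eq_UN by blast
    then have "\<forall>y\<in>F. \<exists>n. y \<in> local_cluster N (hball N n) \<omega> x" by blast
    then obtain f where f: "\<And>y. y \<in> F \<Longrightarrow> y \<in> local_cluster N (hball N (f y)) \<omega> x" by metis
    have "y \<in> local_cluster N (hball N (sum f F)) \<omega> x" if "y \<in> F" for y
    proof -
      have "f y \<le> sum f F" using that F(3) by (intro member_le_sum) auto
      then show ?thesis using f[OF that] incseqD[OF incseq_local_cluster] by blast
    qed
    then have "F \<subseteq> local_cluster N (hball N (sum f F)) \<omega> x" by blast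
    then show "\<exists>n. k \<le> card (local_cluster N (hball N n) \<omega> x)"
      using F(2) card_mono[OF finite_local_cluster[OF finite_hball]] by blast
  qed
next
  assume *: "\<forall>k. \<exists>n. k \<le> card (local_cluster N (hball N n) \<omega> x)"
  show "infinite (cluster N \<omega> x)"
  proof
    assume fin: "finite (cluster N \<omega> x)"
    obtain n where "Suc (card (cluster N \<omega> x)) \<le> card (local_cluster N (hball N n) \<omega> x)" using * by blast
    then show False
      using card_mono[OF fin local_cluster_subset_cluster[of N "hball N n" \<omega> x]] by simp
  qed
qed

text \<open>Here \<open>\<alpha>\<close> is positive because thresholds such as
  \<open>2 * \<beta> / (\<alpha> * \<delta>)\<close> divide by it; \<open>\<alpha> = 0\<close> is
  treated separately at the end.\<close>

locale hierarchical_percolation =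
  fixes N :: nat and \<alpha> \<beta> :: real
  assumes N2: "2 \<le> N" and \<alpha>_pos: "0 < \<alpha>" and \<beta>_pos: "0 < \<beta>"
begin

sublocale bernoulli_product "hedges N" "\<lambda>e. edge_prob \<alpha> \<beta> (edge_length e)"
  using \<alpha>_pos \<beta>_pos by unfold_locales (auto intro: edge_prob_bounds)

lemma percolation_eq: "percolation N \<alpha> \<beta> = P"
  by (simp add: percolation_def P_def)

abbreviation LC :: "(nat \<Rightarrow> nat) set \<Rightarrow> ((nat \<Rightarrow> nat) set \<Rightarrow> bool) \<Rightarrow> (nat \<Rightarrow> nat) \<Rightarrow> (nat \<Rightarrow> nat) set" where
  "LC \<equiv> local_cluster N"

text \<open>Up to the factor \<open>\<alpha> / \<beta>\<close>, the total rate between a vertex of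
  the ball and the sibling ball: \<open>N ^ n\<close> endpoints, each with rate
  \<open>\<alpha> / \<beta> ^ Suc n\<close>.\<close>

definition w :: "nat \<Rightarrow> real" where "w n = (real N / \<beta>) ^ n"

lemma w_pos: "0 < w n"
  using N2 \<beta>_pos by (simp add: w_def)

lemma finite_determined_measurable:
  "finite V \<Longrightarrow> determined_by (edges_in N V) A \<Longrightarrow> A \<inter> space P \<in> sets P"
  using determined_by_measurable[OF finite_edges_in edges_in_subset] .

lemma local_event_measurable:
  "finite V \<Longrightarrow> {\<omega>. Q (LC V \<omega>)} \<inter> space P \<in> sets P"
  by (rule finite_determined_measurable[OF _ determined_by_local_cluster])

definition Inf_event where "Inf_event x = {\<omega>. infinite (cluster N \<omega> x)}"

lemma Inf_event_measurable: "Inf_event x \<inter> space P \<in> sets P"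
proof -
  have "Inf_event x \<inter> space P = (\<Inter>k. \<Union>n. {\<omega>. k \<le> card (LC (hball N n) \<omega> x)} \<inter> space P)"
    by (auto simp: Inf_event_def infinite_cluster_iff)
  also have "\<dots> \<in> sets P"
    by (intro sets.countable_INT sets.countable_UN image_subsetI local_event_measurable finite_hball)
      (auto intro!: local_event_measurable finite_hball)
  finally show ?thesis .
qed

lemma connected_measurable: "{\<omega>. y \<in> cluster N \<omega> x} \<inter> space P \<in> sets P"
proof -
  have "{\<omega>. y \<in> cluster N \<omega> x} \<inter> space P = (\<Union>n. {\<omega>. y \<in> LC (hball N n) \<omega> x} \<inter> space P)"
    unfolding cluster_eq_UN by auto
  also have "\<dots> \<in> sets P"
    using local_event_measurable[OF finite_hball, of "\<lambda>f. y \<in> f x"] by (intro sets.countable_UN) auto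
  finally show ?thesis .
qed

text \<open>An edge of length \<open>k\<close> is closed with probability
  \<open>exp (- (\<alpha> / \<beta> ^ k))\<close>, so rates add up over independent edges.\<close>

lemma prod_closed_between:
  assumes "S \<subseteq> hlattice N" "T \<subseteq> hlattice N" "S \<inter> T = {}"
  shows "(\<Prod>e\<in>edges_between S T. 1 - edge_prob \<alpha> \<beta> (edge_length e)) =
    exp (- (\<Sum>u\<in>S. \<Sum>v\<in>T. \<alpha> / \<beta> ^ hdist u v))"
proof (cases "finite (S \<times> T)")
  case fin: True
  show ?thesis
  proof (cases "S = {} \<or> T = {}")
    case True
    then show ?thesis by (auto simp: edges_between_def)
  next
    case False
    then have f: "finite S" "finite T" using fin finite_cartesian_productD1 finite_cartesian_productD2 by blast+
    have ne: "u \<noteq> v" if "u \<in> S" "v \<in> T" for u v using that assms(3) by blast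
    have "(\<Prod>e\<in>edges_between S T. 1 - edge_prob \<alpha> \<beta> (edge_length e))
        = (\<Prod>(u, v)\<in>S \<times> T. exp (- (\<alpha> / \<beta> ^ hdist u v)))"
      unfolding edges_between_eq_image prod.reindex[OF inj_on_edges_between[OF assms(3)]]
      by (rule prod.cong) (auto simp: ne edge_prob_def)
    also have "\<dots> = exp (\<Sum>(u, v)\<in>S \<times> T. - (\<alpha> / \<beta> ^ hdist u v))"
      using fin by (simp add: exp_sum case_prod_beta)
    also have "\<dots> = exp (- (\<Sum>u\<in>S. \<Sum>v\<in>T. \<alpha> / \<beta> ^ hdist u v))"
      by (simp add: sum.cartesian_product[symmetric] sum_negf)
    finally show ?thesis .
  qed
next
  \<comment> \<open>For infinite index sets products default to 1 and sums to 0, so both sides are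
    1.\<close>
  case False
  have "infinite (edges_between S T)"
    using False finite_image_iff[OF inj_on_edges_between[OF assms(3)]] by (simp add: edges_between_eq_image)
  moreover have "(\<Sum>u\<in>S. \<Sum>v\<in>T. \<alpha> / \<beta> ^ hdist u v) = 0"
    using False by (cases "finite S"; cases "finite T") auto
  ultimately show ?thesis by simp
qed

lemma prob_closed_between:
  assumes "finite S" "finite T" "S \<subseteq> hlattice N" "T \<subseteq> hlattice N" "S \<inter> T = {}"
    and "\<And>u v. u \<in> S \<Longrightarrow> v \<in> T \<Longrightarrow> hdist u v = k"
  shows "prob ({\<omega>. \<forall>e\<in>edges_between S T. \<not> \<omega> e} \<inter> space P) = exp (- (\<alpha> / \<beta> ^ k * (card S * card T)))"
proof -
  have "{\<omega>. \<forall>e\<in>edges_between S T. \<not> \<omega> e} \<inter> space P = {\<omega>\<in>space P. \<forall>e\<in>edges_between S T. \<not> \<omega> e}" by auto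
  then have "prob ({\<omega>. \<forall>e\<in>edges_between S T. \<not> \<omega> e} \<inter> space P) = exp (- (\<Sum>u\<in>S. \<Sum>v\<in>T. \<alpha> / \<beta> ^ hdist u v))"
    using prob_all_closed[OF finite_edges_between[OF assms(1,2)] edges_between_subset[OF assms(3-5)]]
      prod_closed_between[OF assms(3-5)] by simp
  then show ?thesis using assms(6) by (simp add: mult.assoc mult.commute)
qed

lemma closed_between_measurable:
  assumes "finite S" "finite T" "S \<subseteq> hlattice N" "T \<subseteq> hlattice N" "S \<inter> T = {}"
  shows "{\<omega>. \<forall>e\<in>edges_between S T. \<not> \<omega> e} \<inter> space P \<in> sets P"
  by (rule determined_by_measurable[OF finite_edges_between[OF assms(1,2)] edges_between_subset[OF assms(3-5)]])
     (auto simp: determined_by_def)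

text \<open>The shell from radius \<open>k\<close> to \<open>Suc k\<close> has at most
  \<open>N ^ Suc k\<close> points, all at distance \<open>Suc k\<close>, so it contributes at most
  \<open>\<alpha> * w (Suc k)\<close>. This equals the constant
  \<open>\<alpha> * (N / (\<beta> - N))\<close> times \<open>w k - w (Suc k)\<close>, and the sum
  over shells telescopes.\<close>

lemma exit_rate_le:
  assumes "real N < \<beta>" "u \<in> hball N n"
  shows "(\<Sum>v\<in>hball N m - hball N n. \<alpha> / \<beta> ^ hdist u v) \<le> \<alpha> * (real N / (\<beta> - real N)) * w n"
proof -
  let ?C = "\<alpha> * (real N / (\<beta> - real N))"
  have C: "0 \<le> ?C" using assms N2 \<alpha>_pos by simp
  have ge: "(\<Sum>v\<in>hball N m - hball N n. \<alpha> / \<beta> ^ hdist u v) \<le> ?C * (w n - w m)" if "n \<le> m" for m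
    using that
  proof (induction m rule: dec_induct)
    case base
    then show ?case by simp
  next
    case (step m)
    have "u \<in> hball N m" using assms(2) hball_mono[OF step(1)] by blast
    then have d: "hdist u v = Suc m" if "v \<in> hball N (Suc m) - hball N m" for v using hdist_eq_Suc that by blast
    have split: "hball N (Suc m) - hball N n = (hball N m - hball N n) \<union> (hball N (Suc m) - hball N m)"
      using hball_mono[OF step(1)] hball_mono[of m "Suc m" N] by auto
    have "(\<Sum>v\<in>hball N (Suc m) - hball N n. \<alpha> / \<beta> ^ hdist u v) =
      (\<Sum>v\<in>hball N m - hball N n. \<alpha> / \<beta> ^ hdist u v) + (\<Sum>v\<in>hball N (Suc m) - hball N m. \<alpha> / \<beta> ^ hdist u v)"
      unfolding split by (intro sum.union_disjoint) (auto simp: finite_hball)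
    also have "(\<Sum>v\<in>hball N (Suc m) - hball N m. \<alpha> / \<beta> ^ hdist u v)
        = real (card (hball N (Suc m) - hball N m)) * (\<alpha> / \<beta> ^ Suc m)"
      using d by simp
    also have "\<dots> \<le> real N ^ Suc m * (\<alpha> / \<beta> ^ Suc m)"
    proof (rule mult_right_mono)
      have "card (hball N (Suc m) - hball N m) \<le> card (hball N (Suc m))"
        by (intro card_mono) (auto simp: finite_hball)
      then show "real (card (hball N (Suc m) - hball N m)) \<le> real N ^ Suc m"
        using card_hball[of N "Suc m"] N2 by (metis of_nat_le_iff of_nat_power zero_less_numeral less_le_trans)
    qed (use \<alpha>_pos \<beta>_pos in simp)
    also have "\<dots> = ?C * (w m - w (Suc m))"
      using assms(1) \<beta>_pos by (simp add: w_def power_divide divide_simps) (simp add: algebra_simps)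
    finally have "(\<Sum>v\<in>hball N (Suc m) - hball N n. \<alpha> / \<beta> ^ hdist u v) \<le>
      (\<Sum>v\<in>hball N m - hball N n. \<alpha> / \<beta> ^ hdist u v) + ?C * (w m - w (Suc m))" by simp
    then show ?case using step(3) by (simp only: right_diff_distrib)
  qed
  show ?thesis
  proof (cases "n \<le> m")
    case True
    have "?C * (w n - w m) \<le> ?C * w n" using C w_pos[of m] by (intro mult_left_mono) auto
    then show ?thesis using ge[OF True] by simp
  next
    case False
    then have "hball N m - hball N n = {}" using hball_mono[of m n N] by auto
    then have "(\<Sum>v\<in>hball N m - hball N n. \<alpha> / \<beta> ^ hdist u v) = 0" by (simp only: sum.empty)
    moreover have "0 \<le> ?C * w n" by (rule mult_nonneg_nonneg[OF C less_imp_le[OF w_pos]])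
    ultimately show ?thesis by linarith
  qed
qed

lemma edges_in_hball_exhaust:
  "finite (edges_in N (hball N n))" "edges_in N (hball N n) \<subseteq> hedges N"
  "incseq (\<lambda>n. edges_in N (hball N n))" "(\<Union>n. edges_in N (hball N n)) = hedges N"
  using finite_edges_in[OF finite_hball] edges_in_subset UN_edges_in
  by (auto simp: incseq_def intro!: edges_in_mono hball_mono)

text \<open>The edges from a small local cluster out of the ball have total rate at most
  \<open>C * K\<close>. With probability at least \<open>exp (- (C * K))\<close> they are all
  closed, and then the cluster is finite.\<close>

lemma prob_escape_small_local_cluster:
  assumes \<beta>: "real N < \<beta>" and x: "x \<in> hball N n"
    and B: "determined_by (edges_in N (hball N n)) B" and small: "\<And>\<omega>. \<omega> \<in> B \<Longrightarrow> card (LC (hball N n) \<omega> x) * w n < K"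
  defines "C \<equiv> \<alpha> * (real N / (\<beta> - real N))"
  shows "prob (B \<inter> Inf_event x \<inter> space P) \<le> (1 - exp (- (C * K))) * prob (B \<inter> space P)"
proof (rule prob_Int_le_of_atoms[OF edges_in_hball_exhaust(1,2) B Inf_event_measurable])
  fix \<eta> assume \<eta>: "\<eta> \<in> B" "\<eta> \<in> space P"
  define S where "S = LC (hball N n) \<eta> x"
  have C: "0 \<le> C" using \<beta> N2 \<alpha>_pos by (simp add: C_def)
  have S: "S \<subseteq> hball N n" unfolding S_def by (rule local_cluster_subset[OF x])
  let ?F = "\<lambda>m. edges_between S (hball N m - hball N n)"
  have sub: "S \<subseteq> hlattice N" "hball N m - hball N n \<subseteq> hlattice N" "S \<inter> (hball N m - hball N n) = {}" for m
    using S hball_subset by blast+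
  have F: "finite (?F m)" "?F m \<subseteq> hedges N" for m
    using finite_edges_between[OF finite_subset[OF S finite_hball]] finite_hball edges_between_subset[OF sub] by auto
  have incF: "incseq ?F"
  proof (rule incseq_SucI)
    show "?F m \<subseteq> ?F (Suc m)" for m using hball_mono[of m "Suc m" N] by (auto simp: edges_between_def)
  qed
  have ge: "exp (- (C * K)) \<le> (\<Prod>e\<in>?F m. 1 - edge_prob \<alpha> \<beta> (edge_length e))" for m
  proof -
    have "(\<Sum>u\<in>S. \<Sum>v\<in>hball N m - hball N n. \<alpha> / \<beta> ^ hdist u v) \<le> (\<Sum>u\<in>S. C * w n)"
      unfolding C_def using S by (intro sum_mono exit_rate_le \<beta>) auto
    also have "\<dots> = C * (card S * w n)" by simp
    also have "\<dots> \<le> C * K" using small[OF \<eta>(1)] C by (intro mult_left_mono) (auto simp: S_def)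
    finally show ?thesis unfolding prod_closed_between[OF sub] by simp
  qed
  \<comment> \<open>Some edge from \<open>S\<close> out of the ball is open. The edges concerned are
    not inside the ball, so this is independent of the prescribed configuration.\<close>
  define D where "D = {\<omega>. \<exists>e\<in>\<Union>m. ?F m. \<omega> e}"
  let ?Cl = "{\<omega>\<in>space P. \<forall>e\<in>\<Union>m. ?F m. \<not> \<omega> e}"
  have Dsp: "D \<inter> space P = space P - ?Cl" by (auto simp: D_def)
  note cl = prob_all_closed_UN_ge[OF F incF ge]
  show "\<exists>D. D \<inter> space P \<in> sets P \<and> determined_by (hedges N - edges_in N (hball N n)) D \<and>
      prob (D \<inter> space P) \<le> 1 - exp (- (C * K)) \<and>
      (\<forall>\<omega>\<in>space P. (\<forall>e\<in>edges_in N (hball N n). \<omega> e = \<eta> e) \<longrightarrow> \<omega> \<in> Inf_event x \<longrightarrow> \<omega> \<in> D)"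
  proof (intro exI[of _ D] conjI ballI impI)
    show "D \<inter> space P \<in> sets P" unfolding Dsp using cl(1) by (rule sets.compl_sets)
    show "prob (D \<inter> space P) \<le> 1 - exp (- (C * K))"
      unfolding Dsp prob_compl[OF cl(1)] using cl(2) by simp
    show "determined_by (hedges N - edges_in N (hball N n)) D"
    proof (rule determined_by_mono)
      show "determined_by (\<Union>m. ?F m) D" by (auto simp: determined_by_def D_def)
      have "?F m \<inter> edges_in N (hball N n) = {}" for m by (auto simp: edges_between_def edges_in_def)
      then show "(\<Union>m. ?F m) \<subseteq> hedges N - edges_in N (hball N n)" using F(2) by blast
    qed
    fix \<omega> assume eq: "\<forall>e\<in>edges_in N (hball N n). \<omega> e = \<eta> e" and inf: "\<omega> \<in> Inf_event x"
    have LS: "LC (hball N n) \<omega> x = S" unfolding S_def using eq by (intro local_cluster_cong) auto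
    show "\<omega> \<in> D"
    proof (rule ccontr)
      assume nD: "\<omega> \<notin> D"
      have "cluster N \<omega> x = LC (hball N n) \<omega> x"
      proof (rule cluster_eq_local_cluster[OF x])
        fix u v assume u: "u \<in> LC (hball N n) \<omega> x" and v: "v \<in> hlattice N - hball N n"
        obtain m where "v \<in> hball N m" using v UN_hball[of N] by blast
        then have "{u, v} \<in> ?F m" using u v LS by (auto simp: edges_between_def)
        then show "\<not> \<omega> {u, v}" using nD unfolding D_def by blast
      qed
      then show False using inf finite_local_cluster[OF finite_hball] by (simp add: Inf_event_def)
    qed
  qed
qed

text \<open>If \<open>\<beta> > N\<close>, a small local cluster dies with conditional probability
  bounded below at every scale, and the substitute for the 0-1 law applies. If
  \<open>\<beta> \<le> N\<close>, the weights are at least 1 and growth of the local clusters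
  suffices.\<close>

lemma infinite_cluster_locally_large:
  assumes x: "x \<in> hlattice N" and K: "0 \<le> K"
  shows "(\<lambda>n. prob ({\<omega>. card (LC (hball N n) \<omega> x) * w n < K} \<inter> Inf_event x \<inter> space P)) \<longlonglongrightarrow> 0"
proof (cases "real N < \<beta>")
  case True
  define C where "C = \<alpha> * (real N / (\<beta> - real N))"
  have C: "0 \<le> C" using True N2 \<alpha>_pos by (simp add: C_def)
  obtain n0 where n0: "x \<in> hball N n0" using x UN_hball by blast
  show ?thesis
  proof (rule prob_Int_tendsto_0[OF edges_in_hball_exhaust Inf_event_measurable])
    show "determined_by (edges_in N (hball N n)) {\<omega>. card (LC (hball N n) \<omega> x) * w n < K}" for n
      by (rule determined_by_local_cluster)
    show "0 < exp (- (C * K))" by simp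
    show "exp (- (C * K)) \<le> 1" using C K by simp
    fix n B assume n: "n0 \<le> n" and B: "determined_by (edges_in N (hball N n)) B"
      and BA: "B \<subseteq> {\<omega>. card (LC (hball N n) \<omega> x) * w n < K}"
    have "x \<in> hball N n" using n0 hball_mono[OF n] by blast
    then show "prob (B \<inter> Inf_event x \<inter> space P) \<le> (1 - exp (- (C * K))) * prob (B \<inter> space P)"
      unfolding C_def using BA by (intro prob_escape_small_local_cluster[OF True _ B]) auto
  qed
next
  \<comment> \<open>Since \<open>w n\<close> is at least 1, small weighted size implies fewer than
    \<open>K\<close> vertices. These events decrease in \<open>n\<close>, and their intersection
    with an infinite cluster is empty.\<close>
  case False
  then have w1: "1 \<le> w n" for n
    using \<beta>_pos by (simp add: w_def one_le_power)
  let ?G = "\<lambda>n. {\<omega>. card (LC (hball N n) \<omega> x) < K} \<inter> Inf_event x \<inter> space P"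
  have m: "{\<omega>. Q (LC (hball N n) \<omega>)} \<inter> Inf_event x \<inter> space P \<in> sets P" for Q n
  proof -
    have "{\<omega>. Q (LC (hball N n) \<omega>)} \<inter> Inf_event x \<inter> space P
      = ({\<omega>. Q (LC (hball N n) \<omega>)} \<inter> space P) \<inter> (Inf_event x \<inter> space P)" by blast
    then show ?thesis using local_event_measurable[OF finite_hball[of N n], of Q] Inf_event_measurable[of x] by (simp only: sets.Int)
  qed
  have "(\<lambda>n. prob (?G n)) \<longlonglongrightarrow> prob (\<Inter>n. ?G n)"
  proof (rule finite_Lim_measure_decseq)
    show "range ?G \<subseteq> sets P" using m[of "\<lambda>f. card (f x) < K"] by blast
    show "decseq ?G"
    proof (rule decseq_SucI)
      fix n
      have "card (LC (hball N n) \<omega> x) \<le> card (LC (hball N (Suc n)) \<omega> x)" for \<omega>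
        by (intro card_mono finite_local_cluster finite_hball local_cluster_mono hball_mono) simp
      then have "real (card (LC (hball N n) \<omega> x)) \<le> real (card (LC (hball N (Suc n)) \<omega> x))" for \<omega> by simp
      then show "?G (Suc n) \<subseteq> ?G n" by (smt (verit) Int_iff mem_Collect_eq subsetI)
    qed
  qed
  moreover have "(\<Inter>n. ?G n) = {}"
  proof -
    have "\<omega> \<notin> (\<Inter>n. ?G n)" for \<omega>
    proof
      assume *: "\<omega> \<in> (\<Inter>n. ?G n)"
      then have "infinite (cluster N \<omega> x)" by (auto simp: Inf_event_def)
      then obtain n where "nat \<lceil>K\<rceil> \<le> card (LC (hball N n) \<omega> x)" unfolding infinite_cluster_iff by blast
      then have "K \<le> card (LC (hball N n) \<omega> x)" by linarith
      moreover have "\<omega> \<in> ?G n" using * by (rule INT_D) simp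
      ultimately show False by auto
    qed
    then show ?thesis by blast
  qed
  ultimately have lim: "(\<lambda>n. prob (?G n)) \<longlonglongrightarrow> 0" by simp
  show ?thesis
  proof (rule tendsto_sandwich[OF _ _ tendsto_const lim])
    have "prob ({\<omega>. card (LC (hball N n) \<omega> x) * w n < K} \<inter> Inf_event x \<inter> space P) \<le> prob (?G n)" for n
    proof (rule finite_measure_mono)
      have "real (card (LC (hball N n) \<omega> x)) * 1 \<le> card (LC (hball N n) \<omega> x) * w n" for \<omega>
        using w1[of n] by (intro mult_left_mono) auto
      then have "card (LC (hball N n) \<omega> x) * w n < K \<Longrightarrow> card (LC (hball N n) \<omega> x) < K" for \<omega>
        by (metis le_less_trans mult.right_neutral)
      then show "{\<omega>. card (LC (hball N n) \<omega> x) * w n < K} \<inter> Inf_event x \<inter> space P \<subseteq> ?G n" by blast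
      show "?G n \<in> sets P" using m[of "\<lambda>f. card (f x) < K"] .
    qed
    then show "\<forall>\<^sub>F n in sequentially. prob ({\<omega>. card (LC (hball N n) \<omega> x) * w n < K} \<inter> Inf_event x \<inter> space P) \<le> prob (?G n)"
      by simp
  qed simp
qed

text \<open>\<open>Q\<close> sees only the sizes of local clusters, because the isometry moves the
  clusters themselves while preserving their sizes.\<close>

lemma prob_swap_map:
  assumes a: "a \<in> hlattice N" and b: "b \<in> hlattice N" and V: "finite V"
  defines "T \<equiv> swap_map a b"
  shows "prob ({\<omega>. Q (\<lambda>x. card (LC (T ` V) \<omega> (T x)))} \<inter> space P) = prob ({\<omega>. Q (\<lambda>x. card (LC V \<omega> x))} \<inter> space P)"
proof -
  have inv: "T (T v) = v" for v by (simp add: T_def)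
  have lat: "v \<in> hlattice N \<Longrightarrow> T v \<in> hlattice N" for v using swap_map_hlattice[OF a b] by (simp add: T_def)
  have injT: "inj_on T A" for A by (metis inj_onI inv)
  have edge: "T ` e \<in> hedges N \<and> edge_length (T ` e) = edge_length e" if "e \<in> hedges N" for e
  proof -
    obtain x y where xy: "e = {x, y}" "x \<in> hlattice N" "y \<in> hlattice N" "x \<noteq> y" using \<open>e \<in> hedges N\<close> by (auto simp: hedges_def)
    then have ne: "T x \<noteq> T y" using inv by metis
    have "T ` e = {T x, T y}" using xy by simp
    then show ?thesis using xy ne lat by (auto simp: doubleton_in_hedges T_def)
  qed
  have bij: "bij_betw (\<lambda>e. T ` e) (hedges N) (hedges N)"
  proof (rule bij_betw_byWitness[where f' = "\<lambda>e. T ` e"])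
    show "\<forall>e\<in>hedges N. T ` T ` e = e" "\<forall>e\<in>hedges N. T ` T ` e = e" by (simp_all add: image_image inv)
  qed (use edge in blast)+
  let ?A = "{\<omega>. Q (\<lambda>x. card (LC V \<omega> x))} \<inter> space P"
  have "?A \<in> sets P" using local_event_measurable[OF V, of "\<lambda>f. Q (\<lambda>x. card (f x))"] .
  note r = prob_reindex[OF bij _ this]
  have "{\<omega>\<in>space P. (\<lambda>e\<in>hedges N. \<omega> (T ` e)) \<in> ?A} = {\<omega>. Q (\<lambda>x. card (LC (T ` V) \<omega> (T x)))} \<inter> space P"
  proof -
    have "(\<lambda>e\<in>hedges N. \<omega> (T ` e)) \<in> space P" for \<omega> by (simp add: space_P)
    moreover have "card (LC (T ` V) \<omega> (T x)) = card (LC V (\<lambda>e\<in>hedges N. \<omega> (T ` e)) x)" for \<omega> x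
      using local_cluster_move_edges[of T N V \<omega> x] inv lat card_image[OF injT] by (simp add: move_edges_def)
    ultimately show ?thesis by auto
  qed
  then show ?thesis using r edge by simp
qed

end


section \<open>Clusters of positive density\<close>

text \<open>The sets counted are the unions of local clusters of size at least \<open>s\<close>.
  Such clusters are disjoint, so there are at most \<open>card V / s\<close> of them, and a union is
  determined by the clusters it contains.\<close>

lemma card_saturated_le:
  fixes N :: nat and \<eta> :: "(nat \<Rightarrow> nat) set \<Rightarrow> bool" and s :: real
  assumes V: "finite V" and s: "0 < s"
  defines "G \<equiv> {x \<in> V. s \<le> card (local_cluster N V \<eta> x)}"
  shows "finite {A. A \<subseteq> G \<and> (\<forall>x\<in>A. local_cluster N V \<eta> x \<subseteq> A)}"
    and "\<exists>k. real k * s \<le> card V \<and> card {A. A \<subseteq> G \<and> (\<forall>x\<in>A. local_cluster N V \<eta> x \<subseteq> A)} \<le> 2 ^ k"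
proof -
  let ?Sat = "{A. A \<subseteq> G \<and> (\<forall>x\<in>A. local_cluster N V \<eta> x \<subseteq> A)}"
  let ?C = "local_cluster N V \<eta> ` G"
  have G: "finite G" using V by (simp add: G_def)
  then have C: "finite ?C" by blast
  have mem: "finite c \<and> c \<subseteq> V \<and> s \<le> card c" if c: "c \<in> ?C" for c
  proof -
    obtain x where x: "x \<in> G" "c = local_cluster N V \<eta> x" using c by blast
    then show ?thesis using local_cluster_subset[of x V N \<eta>] finite_subset[OF _ V] by (auto simp: G_def)
  qed
  have disj: "c \<inter> d = {}" if cd: "c \<in> ?C" "d \<in> ?C" "c \<noteq> d" for c d
  proof (rule ccontr)
    assume "c \<inter> d \<noteq> {}"
    then obtain z where "z \<in> c" "z \<in> d" by blast
    then show False using cd local_cluster_eqI[of z N V \<eta>] by (metis image_iff)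
  qed
  have "real (card ?C) * s = (\<Sum>c\<in>?C. s)" by simp
  also have "\<dots> \<le> (\<Sum>c\<in>?C. real (card c))" using mem by (intro sum_mono) blast
  also have "\<dots> = real (card (\<Union>?C))"
    using mem disj by (subst card_Union_disjoint) (auto simp: pairwise_def disjnt_def)
  also have "\<dots> \<le> real (card V)"
    using mem by (intro of_nat_mono card_mono V) blast
  finally have k: "real (card ?C) * s \<le> card V" .
  have inj: "inj_on (\<lambda>A. {c \<in> ?C. c \<subseteq> A}) ?Sat"
  proof (rule inj_on_inverseI[where g = Union])
    fix A assume A: "A \<in> ?Sat"
    show "\<Union>{c \<in> ?C. c \<subseteq> A} = A"
    proof
      show "A \<subseteq> \<Union>{c \<in> ?C. c \<subseteq> A}"
      proof
        fix x assume "x \<in> A"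
        then have "local_cluster N V \<eta> x \<in> {c \<in> ?C. c \<subseteq> A}" using A by blast
        then show "x \<in> \<Union>{c \<in> ?C. c \<subseteq> A}" using self_in_local_cluster by blast
      qed
    qed blast
  qed
  have sub: "(\<lambda>A. {c \<in> ?C. c \<subseteq> A}) ` ?Sat \<subseteq> Pow ?C" by blast
  show fin: "finite ?Sat" by (rule finite_subset[of _ "Pow G"]) (use G in auto)
  have "card ?Sat \<le> card (Pow ?C)" using card_inj_on_le[OF inj sub] C by blast
  then have "card ?Sat \<le> 2 ^ card ?C" using C by (simp add: card_Pow)
  then show "\<exists>k. real k * s \<le> card V \<and> card ?Sat \<le> 2 ^ k" using k by blast
qed

lemma exp_2_ge: "4 \<le> exp (2::real)"
proof -
  have "2 \<le> exp (1::real)" using exp_ge_add_one_self[of 1] by simp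
  then have "2 * 2 \<le> exp (1::real) * exp 1" by (intro mult_mono) auto
  then show ?thesis by (simp add: exp_add[symmetric])
qed

text \<open>When every cluster of \<open>U \<union> U'\<close> holds less than a third of
  \<open>G\<close>, some of them can be united to a set \<open>X\<close> holding between one and two
  thirds of \<open>G\<close>. No open edge of \<open>U \<union> U'\<close> leaves \<open>X\<close>,
  so cutting along \<open>X\<close> separates part of \<open>G\<close> from part of
  \<open>G'\<close>.\<close>

lemma split_without_large_cluster:
  fixes g :: real
  assumes V: "finite U" "finite U'" and UU: "U \<inter> U' = {}"
    and small: "\<And>x. x \<in> U \<union> U' \<Longrightarrow> card (local_cluster N (U \<union> U') \<omega> x) < g"
    and G: "G \<subseteq> U" "\<And>x. x \<in> G \<Longrightarrow> local_cluster N U \<omega> x \<subseteq> G" "3 * g \<le> card G"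
    and G': "G' \<subseteq> U'" "\<And>x. x \<in> G' \<Longrightarrow> local_cluster N U' \<omega> x \<subseteq> G'"
    and lat: "U \<subseteq> hlattice N" "U' \<subseteq> hlattice N"
  obtains A B where "A \<subseteq> G" "\<And>x. x \<in> A \<Longrightarrow> local_cluster N U \<omega> x \<subseteq> A" "card G \<le> 3 * card A"
    "B \<subseteq> G'" "\<And>x. x \<in> B \<Longrightarrow> local_cluster N U' \<omega> x \<subseteq> B" "card G' \<le> 2 * card B"
    "\<forall>e\<in>edges_between A B. \<not> \<omega> e"
proof -
  let ?W = "U \<union> U'"
  let ?L = "local_cluster N ?W \<omega>"
  let ?D = "?L ` ?W"
  let ?w = "\<lambda>d. real (card (d \<inter> G))"
  have finG: "finite G" "finite G'" using G(1) G'(1) V finite_subset by blast+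
  have finW: "finite ?W" using V by simp
  have finD: "finite ?D" using finW by (rule finite_imageI)
  have disj: "c \<inter> d = {}" if cd: "c \<in> ?D" "d \<in> ?D" "c \<noteq> d" for c d
  proof (rule ccontr)
    assume "c \<inter> d \<noteq> {}"
    then obtain z where "z \<in> c" "z \<in> d" by blast
    then show False using cd local_cluster_eqI[of z N ?W \<omega>] by (metis image_iff)
  qed
  have "\<Union>((\<lambda>d. d \<inter> G) ` ?D) = G"
  proof
    show "G \<subseteq> \<Union>((\<lambda>d. d \<inter> G) ` ?D)"
    proof
      fix x assume x: "x \<in> G"
      then have "x \<in> ?L x \<inter> G" "?L x \<in> ?D" using G(1) by auto
      then show "x \<in> \<Union>((\<lambda>d. d \<inter> G) ` ?D)" by blast
    qed
  qed blast
  then have "real (card G) = real (card (\<Union>d\<in>?D. d \<inter> G))" by simp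
  also have "\<dots> = sum ?w ?D"
    using finD finG disj by (subst card_UN_disjoint) auto
  finally have tot: "sum ?w ?D = card G" ..
  have wlt: "?w d < sum ?w ?D / 3" if d: "d \<in> ?D" for d
  proof -
    obtain x where x: "x \<in> ?W" "d = ?L x" using d by blast
    have "card (d \<inter> G) \<le> card d"
      using x finite_local_cluster[OF finW] by (intro card_mono) auto
    moreover have "card d < g" using small x by simp
    ultimately show ?thesis using G(3) unfolding tot by simp
  qed
  obtain D' where D': "D' \<subseteq> ?D" "sum ?w ?D / 3 \<le> sum ?w D'" "sum ?w D' \<le> 2 * sum ?w ?D / 3"
    by (rule subset_sum_middle_third[OF finD _ wlt]) auto
  define X where "X = \<Union>D'"
  have "finite D'" using D'(1) finD finite_subset by blast
  have "X \<inter> G = (\<Union>d\<in>D'. d \<inter> G)" unfolding X_def by blast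
  then have "real (card (X \<inter> G)) = real (card (\<Union>d\<in>D'. d \<inter> G))" by simp
  also have "\<dots> = sum ?w D'"
  proof -
    have "\<forall>c\<in>D'. \<forall>d\<in>D'. c \<noteq> d \<longrightarrow> (c \<inter> G) \<inter> (d \<inter> G) = {}"
    proof (intro ballI impI)
      fix c d assume "c \<in> D'" "d \<in> D'" "c \<noteq> d"
      then have "c \<inter> d = {}" by (intro disj subsetD[OF D'(1)])
      then show "(c \<inter> G) \<inter> (d \<inter> G) = {}" by blast
    qed
    then have "card (\<Union>d\<in>D'. d \<inter> G) = (\<Sum>d\<in>D'. card (d \<inter> G))"
      using \<open>finite D'\<close> finG(1) by (intro card_UN_disjoint) auto
    then show ?thesis by simp
  qed
  finally have XG: "real (card (X \<inter> G)) = sum ?w D'" .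
  have Xcl: "?L x \<subseteq> X" if "x \<in> X" for x
  proof -
    obtain d where d: "d \<in> D'" "x \<in> d" using \<open>x \<in> X\<close> by (auto simp: X_def)
    have "d \<in> ?D" using D'(1) d(1) by (rule subsetD)
    then obtain y where y: "d = ?L y" by (rule imageE)
    have "?L x = d" using local_cluster_eqI[of x N ?W \<omega> y] d(2) y by simp
    then show ?thesis using d by (auto simp: X_def)
  qed
  have Xc: "\<not> \<omega> {u, v}" if "u \<in> X" "v \<notin> X" "u \<in> ?W" "v \<in> ?W" for u v
  proof
    assume "\<omega> {u, v}"
    then have "adjacent N \<omega> u v" using that lat by (auto simp: adjacent_def doubleton_in_hedges)
    then have "v \<in> ?L u" using local_cluster_step[of u N ?W \<omega> u v] that by simp
    then show False using Xcl that by blast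
  qed
  have cl: "local_cluster N V \<omega> x \<subseteq> X" if "x \<in> X" "V \<subseteq> ?W" for x V
    using Xcl[OF that(1)] local_cluster_mono[OF that(2)] by blast
  have ncl: "local_cluster N V \<omega> x \<inter> X = {}" if "x \<notin> X" "V \<subseteq> ?W" for x V
  proof (rule ccontr)
    assume "local_cluster N V \<omega> x \<inter> X \<noteq> {}"
    then obtain y where y: "y \<in> local_cluster N V \<omega> x" "y \<in> X" by blast
    then have "x \<in> local_cluster N V \<omega> y" using local_cluster_eqI[OF y(1)] by simp
    then show False using cl[OF y(2) that(2)] that(1) by blast
  qed
  have split: "card H = card (X \<inter> H) + card (H - X)" if "finite H" for H :: "(nat \<Rightarrow> nat) set"
    using card_Int_Diff[OF that, of X] by (simp add: Int_commute)
  show thesis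
  \<comment> \<open>Either \<open>X\<close> or its complement holds at least half of
    \<open>G'\<close>. Since both hold at least a third of \<open>G\<close>, the opposite side can
    be used there.\<close>
  proof (cases "2 * card (X \<inter> G') \<le> card G'")
    case True
    show thesis
    proof (rule that[of "X \<inter> G" "G' - X"])
      show "card G \<le> 3 * card (X \<inter> G)" using D'(2) XG tot by simp
      show "card G' \<le> 2 * card (G' - X)" using True split[OF finG(2)] by simp
      show "\<forall>e\<in>edges_between (X \<inter> G) (G' - X). \<not> \<omega> e"
        using Xc G(1) G'(1) unfolding edges_between_def by blast
      show "local_cluster N U \<omega> x \<subseteq> X \<inter> G" if "x \<in> X \<inter> G" for x
        using that cl[of x U] G(2)[of x] by blast
      show "local_cluster N U' \<omega> x \<subseteq> G' - X" if "x \<in> G' - X" for x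
        using that ncl[of x U'] G'(2)[of x] by blast
    qed auto
  next
    case False
    show thesis
    proof (rule that[of "G - X" "X \<inter> G'"])
      have "real (card (G - X)) = card G - real (card (X \<inter> G))" using split[OF finG(1)] by simp
      then show "card G \<le> 3 * card (G - X)" using D'(3) XG tot by simp
      show "card G' \<le> 2 * card (X \<inter> G')" using False by simp
      show "\<forall>e\<in>edges_between (G - X) (X \<inter> G'). \<not> \<omega> e"
      proof
        fix e assume "e \<in> edges_between (G - X) (X \<inter> G')"
        then obtain u v where "e = {v, u}" "u \<in> G - X" "v \<in> X \<inter> G'"
          unfolding edges_between_def by (auto simp: insert_commute)
        then show "\<not> \<omega> e" using Xc[of v u] G(1) G'(1) by blast
      qed
      show "local_cluster N U \<omega> x \<subseteq> G - X" if "x \<in> G - X" for x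
        using that ncl[of x U] G(2)[of x] by blast
      show "local_cluster N U' \<omega> x \<subseteq> X \<inter> G'" if "x \<in> X \<inter> G'" for x
        using that cl[of x U'] G'(2)[of x] by blast
    qed auto
  qed
qed

section \<open>Merging of the large clusters of two sibling balls\<close>

context hierarchical_percolation
begin

definition large_mass ::
  "(nat \<Rightarrow> nat) set \<Rightarrow> real \<Rightarrow> real \<Rightarrow> nat \<Rightarrow> ((nat \<Rightarrow> nat) set \<Rightarrow> bool) set" where
  "large_mass V K q n = {\<omega>. q * real (card V) \<le> real (card {x \<in> V. K \<le> card (LC V \<omega> x) * w n})}"

definition giant :: "(nat \<Rightarrow> nat) set \<Rightarrow> real \<Rightarrow> ((nat \<Rightarrow> nat) set \<Rightarrow> bool) set" where
  "giant V g = {\<omega>. \<exists>x\<in>V. g \<le> card (LC V \<omega> x)}"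

lemma determined_by_large_mass: "determined_by (edges_in N V) (large_mass V K q n)"
  unfolding large_mass_def by (rule determined_by_local_cluster)

lemma determined_by_giant: "determined_by (edges_in N V) (giant V g)"
  unfolding giant_def by (rule determined_by_local_cluster)

lemma finite_sibling: "finite (sibling N n)"
  using sibling_subset finite_hball[of N "Suc n"] by (meson Diff_subset finite_subset order_trans)

lemma sibling_lattice: "sibling N n \<subseteq> hlattice N"
  by (auto simp: sibling_def)

lemma hball_sibling_disjoint: "hball N n \<inter> sibling N n = {}"
  using sibling_subset by blast

lemma hdist_hball_sibling: "u \<in> hball N n \<Longrightarrow> v \<in> sibling N n \<Longrightarrow> hdist u v = Suc n"
  using sibling_subset hdist_eq_Suc by blast

lemma card_hball_eq_power: "card (hball N n) = N ^ n"
  using card_hball N2 by simp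

lemma card_sibling: "card (sibling N n) = N ^ n"
  using swap_map_image_sibling(3)[OF N2, of n] card_hball_eq_power
  by (metis card_image inj_onI swap_map_involutory)

lemma edges_disjoint: "U \<inter> V = {} \<Longrightarrow> edges_in N U \<inter> edges_in N V = {}"
  by (auto simp: edges_in_def hedges_def)

text \<open>The limit is used at \<open>x0\<close> alone, where discarding the vanishing bad event
  leaves half of the probability. Isometries carry the bound to all vertices of both balls, so a
  single \<open>n0\<close> serves them all.\<close>

lemma prob_local_cluster_large:
  assumes x0: "x0 \<in> hlattice N" and \<theta>: "0 < prob (Inf_event x0 \<inter> space P)" and K: "0 \<le> K"
  shows "\<exists>n0. \<forall>n\<ge>n0. \<forall>V\<in>{hball N n, sibling N n}. \<forall>x\<in>V.
    prob (Inf_event x0 \<inter> space P) / 2 \<le> prob ({\<omega>. K \<le> card (LC V \<omega> x) * w n} \<inter> space P)"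
proof -
  let ?\<theta> = "prob (Inf_event x0 \<inter> space P)"
  let ?bad = "\<lambda>n. {\<omega>. card (LC (hball N n) \<omega> x0) * w n < K}"
  have "\<forall>\<^sub>F n in sequentially. prob (?bad n \<inter> Inf_event x0 \<inter> space P) < ?\<theta> / 2"
    using infinite_cluster_locally_large[OF x0 K] \<theta> by (intro order_tendstoD(2)) auto
  then obtain n1 where n1: "\<And>n. n \<ge> n1 \<Longrightarrow> prob (?bad n \<inter> Inf_event x0 \<inter> space P) < ?\<theta> / 2"
    by (auto simp: eventually_sequentially)
  obtain n2 where n2: "x0 \<in> hball N n2" using x0 UN_hball by blast
  show ?thesis
  proof (intro exI[of _ "max n1 n2"] allI impI)
    fix n assume n: "max n1 n2 \<le> n"
    have xn: "x0 \<in> hball N n" using n2 n hball_mono[of n2 n N] by auto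
    let ?good = "\<lambda>V x. {\<omega>. K \<le> card (LC V \<omega> x) * w n} \<inter> space P"
    have gm: "?good (hball N n) x0 \<in> sets P"
      using local_event_measurable[OF finite_hball[of N n], of "\<lambda>f. K \<le> card (f x0) * w n"] .
    have bm: "?bad n \<inter> space P \<in> sets P"
      using local_event_measurable[OF finite_hball[of N n], of "\<lambda>f. card (f x0) * w n < K"] .
    have bim: "?bad n \<inter> Inf_event x0 \<inter> space P \<in> sets P"
    proof -
      have "?bad n \<inter> Inf_event x0 \<inter> space P = (?bad n \<inter> space P) \<inter> (Inf_event x0 \<inter> space P)" by blast
      then show ?thesis using bm Inf_event_measurable by (simp only: sets.Int)
    qed
    have "?\<theta> \<le> prob (?good (hball N n) x0 \<union> (?bad n \<inter> Inf_event x0 \<inter> space P))"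
      by (rule finite_measure_mono[OF _ sets.Un[OF gm bim]]) auto
    also have "\<dots> \<le> prob (?good (hball N n) x0) + prob (?bad n \<inter> Inf_event x0 \<inter> space P)"
      by (rule measure_Un_le[OF gm bim])
    finally have base: "?\<theta> / 2 \<le> prob (?good (hball N n) x0)" using n1[of n] n by simp
    have ball: "?\<theta> / 2 \<le> prob (?good (hball N n) x)" if x: "x \<in> hball N n" for x
    proof -
      have "x \<in> hlattice N" using x hball_subset by blast
      from prob_swap_map[OF x0 this finite_hball[of N n], of "\<lambda>f. K \<le> f x0 * w n"]
      show ?thesis using base by (simp add: swap_map_image_hball[OF xn x])
    qed
    have sib: "?\<theta> / 2 \<le> prob (?good (sibling N n) x)" if x: "x \<in> sibling N n" for x
    proof -
      define b where "b = (\<lambda>i. if i = n then 1 else 0 :: nat)"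
      note sw = swap_map_image_sibling(1)[OF N2] swap_map_image_sibling(2,3)[OF N2, of n, folded b_def]
      obtain y where y: "y \<in> hball N n" "x = swap_map (\<lambda>_. 0) b y" using x unfolding sw(3)[symmetric] by blast
      from prob_swap_map[OF sw(1,2) finite_hball[of N n], of "\<lambda>f. K \<le> f y * w n"]
      show ?thesis using ball[OF y(1)] by (simp add: sw(3) y(2))
    qed
    show "\<forall>V\<in>{hball N n, sibling N n}. \<forall>x\<in>V. ?\<theta> / 2 \<le> prob (?good V x)"
      using ball sib by blast
  qed
qed

text \<open>The factor 4 loses a half twice: each vertex has a large local cluster with probability
  at least \<open>2 * q\<close>, and the reverse Markov inequality turns this into a fraction
  \<open>q\<close> with probability \<open>q\<close>.\<close>

lemma prob_large_mass:
  assumes x0: "x0 \<in> hlattice N" and \<theta>: "0 < prob (Inf_event x0 \<inter> space P)" and K: "0 \<le> K"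
  defines "q \<equiv> prob (Inf_event x0 \<inter> space P) / 4"
  shows "\<exists>n0. \<forall>n\<ge>n0. \<forall>V\<in>{hball N n, sibling N n}. q \<le> prob (large_mass V K q n \<inter> space P)"
proof -
  obtain n0 where n0: "\<And>n V x. n \<ge> n0 \<Longrightarrow> V \<in> {hball N n, sibling N n} \<Longrightarrow> x \<in> V \<Longrightarrow>
    2 * q \<le> prob ({\<omega>. K \<le> card (LC V \<omega> x) * w n} \<inter> space P)"
    using prob_local_cluster_large[OF x0 \<theta> K] by (auto simp: q_def)
  show ?thesis
  proof (intro exI[of _ n0] allI impI ballI)
    fix n V assume n: "n0 \<le> n" and V: "V \<in> {hball N n, sibling N n}"
    have fin: "finite V" and card: "card V = N ^ n" using V finite_hball finite_sibling card_hball_eq_power card_sibling by auto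
    have ne: "V \<noteq> {}" using card N2 by auto
    let ?A = "\<lambda>x. {\<omega>. K \<le> card (LC V \<omega> x) * w n} \<inter> space P"
    have eq: "{\<omega>\<in>space P. q * real (card V) \<le> real (card {x\<in>V. \<omega> \<in> ?A x})} = large_mass V K q n \<inter> space P"
    proof -
      have "{x\<in>V. \<omega> \<in> ?A x} = {x\<in>V. K \<le> card (LC V \<omega> x) * w n}" if "\<omega> \<in> space P" for \<omega> using that by auto
      then show ?thesis by (auto simp: large_mass_def)
    qed
    have m: "large_mass V K q n \<inter> space P \<in> sets P"
      by (rule finite_determined_measurable[OF fin determined_by_large_mass])
    have "q \<le> prob {\<omega>\<in>space P. q * real (card V) \<le> real (card {x\<in>V. \<omega> \<in> ?A x})}"
    proof (rule prob_many_events_ge[OF fin ne])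
      show "?A x \<in> sets P" for x
        using local_event_measurable[OF fin, of "\<lambda>f. K \<le> card (f x) * w n"] .
      show "2 * q \<le> prob (?A x)" if "x \<in> V" for x using n0[OF n V that] .
      show "0 \<le> q" using \<theta> by (simp add: q_def)
      show "{\<omega>\<in>space P. q * real (card V) \<le> real (card {x\<in>V. \<omega> \<in> ?A x})} \<in> sets P"
        unfolding eq by (rule m)
    qed
    then show "q \<le> prob (large_mass V K q n \<inter> space P)" unfolding eq .
  qed
qed

text \<open>Condition on the configuration inside both balls. Absence of a large cluster forces
  closed edges between two unions of internal clusters, one per ball, each of positive density. A
  union bound suffices because internal clusters of size at least \<open>K / w n\<close> have few
  unions.\<close>

lemma prob_no_large_cluster:
  fixes n :: nat and q :: real
  assumes q: "0 < q"
  defines "K \<equiv> 24 * \<beta> / (\<alpha> * q\<^sup>2)"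
  defines "B \<equiv> large_mass (hball N n) K q n \<inter> large_mass (sibling N n) K q n"
  shows "prob (B \<inter> {\<omega>. \<forall>x\<in>hball N n \<union> sibling N n. card (LC (hball N n \<union> sibling N n) \<omega> x) < q * N ^ n / 3} \<inter> space P)
    \<le> 1 / 2 * prob (B \<inter> space P)"
proof -
  let ?U = "hball N n" and ?U' = "sibling N n"
  let ?J = "edges_in N ?U \<union> edges_in N ?U'"
  let ?E = "{\<omega>. \<forall>x\<in>?U \<union> ?U'. card (LC (?U \<union> ?U') \<omega> x) < q * N ^ n / 3}"
  have fU: "finite ?U" "finite ?U'" by (rule finite_hball finite_sibling)+
  have lat: "?U \<subseteq> hlattice N" "?U' \<subseteq> hlattice N" by (rule hball_subset sibling_lattice)+
  have K: "0 < K" using q \<alpha>_pos \<beta>_pos by (simp add: K_def)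
  define b where "b = real N ^ n"
  have b: "0 < b" using N2 by (simp add: b_def)
  have Jf: "finite ?J" "?J \<subseteq> hedges N" using finite_edges_in fU edges_in_subset by auto
  have Bd: "determined_by ?J B"
    unfolding B_def by (intro determined_by_Int; rule determined_by_mono[OF determined_by_large_mass]) auto
  have Em: "?E \<inter> space P \<in> sets P" using fU by (intro local_event_measurable) auto
  show ?thesis
  proof (rule prob_Int_le_of_atoms[OF Jf Bd Em])
    fix \<eta> assume \<eta>: "\<eta> \<in> B" "\<eta> \<in> space P"
    define G where "G = {x \<in> ?U. K / w n \<le> card (LC ?U \<eta> x)}"
    define G' where "G' = {x \<in> ?U'. K / w n \<le> card (LC ?U' \<eta> x)}"
    let ?S = "{A. A \<subseteq> G \<and> (\<forall>x\<in>A. LC ?U \<eta> x \<subseteq> A)}"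
    let ?S' = "{A. A \<subseteq> G' \<and> (\<forall>x\<in>A. LC ?U' \<eta> x \<subseteq> A)}"
    have s: "0 < K / w n" using K w_pos by simp
    have Geq: "G = {x \<in> ?U. K \<le> card (LC ?U \<eta> x) * w n}" "G' = {x \<in> ?U'. K \<le> card (LC ?U' \<eta> x) * w n}"
      using w_pos[of n] by (auto simp: G_def G'_def field_simps)
    have cG: "q * b \<le> card G" "q * b \<le> card G'"
      using \<eta>(1) unfolding B_def large_mass_def Geq card_hball_eq_power card_sibling by (auto simp: b_def)
    have fG: "finite G" "finite G'" using fU by (auto simp: G_def G'_def)
    obtain k where k: "real k * (K / w n) \<le> b" "card ?S \<le> 2 ^ k" "finite ?S"
      using card_saturated_le[OF fU(1) s, of N \<eta>] unfolding G_def card_hball_eq_power by (auto simp: b_def)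
    obtain k' where k': "real k' * (K / w n) \<le> b" "card ?S' \<le> 2 ^ k'" "finite ?S'"
      using card_saturated_le[OF fU(2) s, of N \<eta>] unfolding G'_def card_sibling by (auto simp: b_def)
    \<comment> \<open>The candidate pairs depend only on \<open>\<eta>\<close>, so the event
      \<open>D\<close> below looks only at edges between the two balls.\<close>
    define I where "I = {(A, A'). A \<in> ?S \<and> A' \<in> ?S' \<and> card G \<le> 3 * card A \<and> card G' \<le> 2 * card A'}"
    have Isub: "I \<subseteq> ?S \<times> ?S'" by (auto simp: I_def)
    have fI: "finite I" by (rule finite_subset[OF Isub finite_cartesian_product[OF k(3) k'(3)]])
    define Cl where "Cl = (\<lambda>(A, A'). {\<omega>. \<forall>e\<in>edges_between A A'. \<not> \<omega> e} :: ((nat \<Rightarrow> nat) set \<Rightarrow> bool) set)"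
    define D where "D = (\<Union>i\<in>I. Cl i)"
    have I_props: "finite A" "finite A'" "A \<subseteq> ?U" "A' \<subseteq> ?U'" "A \<subseteq> hlattice N" "A' \<subseteq> hlattice N" "A \<inter> A' = {}"
      if "(A, A') \<in> I" for A A'
    proof -
      show *: "A \<subseteq> ?U" "A' \<subseteq> ?U'" using that by (auto simp: I_def G_def G'_def)
      show "finite A" "finite A'" using * fU finite_subset by blast+
      show "A \<subseteq> hlattice N" "A' \<subseteq> hlattice N" using * lat by blast+
      show "A \<inter> A' = {}" using * hball_sibling_disjoint by blast
    qed
    have Clm: "Cl i \<inter> space P \<in> sets P" if "i \<in> I" for i
    proof -
      obtain A A' where i: "i = (A, A')" by (cases i)
      have AI: "(A, A') \<in> I" using that i by simp
      show ?thesis unfolding i Cl_def prod.case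
        by (rule closed_between_measurable[OF I_props(1,2,5,6,7)[OF AI]])
    qed
    have Deq: "D \<inter> space P = (\<Union>i\<in>I. Cl i \<inter> space P)" by (auto simp: D_def)
    \<comment> \<open>Sizes \<open>q * b / 3\<close> and \<open>q * b / 2\<close> and the rate
      \<open>\<alpha> / \<beta>\<close> combine to the exponent \<open>c * (b * w n)\<close> of one
      pair. \<open>K = 4 / c\<close> makes the number of pairs cost only half of it.\<close>
    define c where "c = \<alpha> * q\<^sup>2 / (6 * \<beta>)"
    have c: "0 < c" using q \<alpha>_pos \<beta>_pos by (simp add: c_def)
    have Kc: "K = 4 / c" by (simp add: K_def c_def)
    have rate: "\<alpha> / \<beta> ^ Suc n * (b * b) = \<alpha> / \<beta> * (b * w n)"
      by (simp add: w_def b_def power_divide)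
    have pr: "prob (Cl i \<inter> space P) \<le> exp (- (c * (b * w n)))" if "i \<in> I" for i
    proof -
      obtain A A' where i: "i = (A, A')" by (cases i)
      have AI: "(A, A') \<in> I" using that i by simp
      have "prob (Cl i \<inter> space P) = exp (- (\<alpha> / \<beta> ^ Suc n * (card A * card A')))"
        unfolding i Cl_def prod.case
      proof (rule prob_closed_between[OF I_props(1,2,5,6,7)[OF AI]])
        show "hdist u v = Suc n" if "u \<in> A" "v \<in> A'" for u v
          using that I_props(3,4)[OF AI] by (intro hdist_hball_sibling) auto
      qed
      also have "\<dots> \<le> exp (- (c * (b * w n)))"
      proof -
        have 1: "q * b / 3 \<le> card A" "q * b / 2 \<le> card A'"
          using AI cG by (auto simp: I_def)
        have "q * b / 3 * (q * b / 2) \<le> real (card A) * real (card A')"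
          using 1 q b by (intro mult_mono) auto
        then have "\<alpha> / \<beta> ^ Suc n * (q * b / 3 * (q * b / 2)) \<le> \<alpha> / \<beta> ^ Suc n * (real (card A) * real (card A'))"
          using \<alpha>_pos \<beta>_pos by (intro mult_left_mono) auto
        moreover have "\<alpha> / \<beta> ^ Suc n * (q * b / 3 * (q * b / 2)) = q\<^sup>2 / 6 * (\<alpha> / \<beta> ^ Suc n * (b * b))"
          by (simp add: power2_eq_square mult_ac)
        moreover have "q\<^sup>2 / 6 * (\<alpha> / \<beta> * (b * w n)) = c * (b * w n)" by (simp add: c_def)
        ultimately show ?thesis unfolding rate by simp
      qed
      finally show ?thesis .
    qed
    have "prob (D \<inter> space P) \<le> (\<Sum>i\<in>I. prob (Cl i \<inter> space P))"
      unfolding Deq using Clm by (intro finite_measure_subadditive_finite[OF fI]) blast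
    also have "\<dots> \<le> (\<Sum>i\<in>I. exp (- (c * (b * w n))))" by (rule sum_mono[OF pr])
    also have "\<dots> = real (card I) * exp (- (c * (b * w n)))" by simp
    \<comment> \<open>Each ball has at most \<open>b * w n / K\<close> large internal clusters,
      giving at most \<open>2 ^ (k + k')\<close> pairs, and \<open>2 \<le> exp 1\<close>.\<close>
    also have "\<dots> \<le> exp (2 * (b * w n / K)) * exp (- (c * (b * w n)))"
    proof (rule mult_right_mono)
      have "card I \<le> card (?S \<times> ?S')" by (rule card_mono[OF finite_cartesian_product[OF k(3) k'(3)] Isub])
      also have "\<dots> \<le> 2 ^ k * 2 ^ k'" using k(2) k'(2) by (simp add: card_cartesian_product mult_mono)
      finally have "real (card I) \<le> 2 ^ (k + k')" by (simp add: power_add of_nat_le_iff[symmetric, where 'a = real] del: of_nat_le_iff)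
      also have "\<dots> \<le> exp 1 ^ (k + k')"
        using exp_ge_add_one_self[of "1::real"] by (intro power_mono) auto
      also have "\<dots> = exp (real k + real k')" by (simp add: exp_of_nat_mult[symmetric])
      also have "\<dots> \<le> exp (2 * (b * w n / K))"
      proof -
        have "real k \<le> b * w n / K" "real k' \<le> b * w n / K"
          using k(1) k'(1) K w_pos[of n] by (auto simp: field_simps)
        from add_mono[OF this] show ?thesis unfolding exp_le_cancel_iff mult_2 .
      qed
      finally show "real (card I) \<le> exp (2 * (b * w n / K))" .
    qed simp
    also have "\<dots> = exp (- (c * (b * w n) / 2))"
      using c by (simp add: Kc exp_add[symmetric] field_simps)
    \<comment> \<open>\<open>G\<close> is nonempty and a cluster in it has at least
      \<open>K / w n\<close> and at most \<open>b\<close> vertices. Hence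
      \<open>b * w n \<ge> K = 4 / c\<close>, for every \<open>n\<close>.\<close>
    also have "\<dots> \<le> exp (- 2)"
    proof -
      have "0 < real (card G)" using cG(1) q b by (meson less_le_trans mult_pos_pos)
      then obtain x where x: "x \<in> G" by (auto simp: card_gt_0_iff)
      then have "K \<le> card (LC ?U \<eta> x) * w n" "x \<in> ?U" by (auto simp: Geq)
      moreover have "card (LC ?U \<eta> x) \<le> card ?U"
        using local_cluster_subset[OF \<open>x \<in> ?U\<close>] by (intro card_mono fU)
      then have "real (card (LC ?U \<eta> x)) \<le> b" unfolding card_hball_eq_power b_def by (metis of_nat_le_iff of_nat_power)
      then have "card (LC ?U \<eta> x) * w n \<le> b * w n" using w_pos[of n] by (intro mult_right_mono) auto
      ultimately have "4 / c \<le> b * w n" unfolding Kc by simp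
      then have "2 \<le> c * (b * w n) / 2" using c by (simp add: field_simps)
      then show ?thesis by simp
    qed
    also have "\<dots> \<le> 1 / 2" using exp_2_ge by (simp add: exp_minus field_simps)
    finally have pD: "prob (D \<inter> space P) \<le> 1 / 2" .
    show "\<exists>D. D \<inter> space P \<in> sets P \<and> determined_by (hedges N - ?J) D \<and>
      prob (D \<inter> space P) \<le> 1 / 2 \<and> (\<forall>\<omega>\<in>space P. (\<forall>i\<in>?J. \<omega> i = \<eta> i) \<longrightarrow> \<omega> \<in> ?E \<longrightarrow> \<omega> \<in> D)"
    proof (intro exI[of _ D] conjI ballI impI pD)
      show "D \<inter> space P \<in> sets P" unfolding Deq using Clm fI by (intro sets.finite_UN) auto
      show "determined_by (hedges N - ?J) D"
        unfolding D_def
      proof (rule determined_by_UN)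
        fix i assume "i \<in> I"
        then obtain A A' where i: "i = (A, A')" and AI: "(A, A') \<in> I" by (cases i) auto
        show "determined_by (hedges N - ?J) (Cl i)"
        proof (rule determined_by_mono)
          show "determined_by (edges_between A A') (Cl i)" by (auto simp: i Cl_def determined_by_def)
          have "e \<notin> ?J" if "e \<in> edges_between A A'" for e
            using that I_props(3,4)[OF AI] hball_sibling_disjoint[of n] by (auto simp: edges_between_def edges_in_def)
          then show "edges_between A A' \<subseteq> hedges N - ?J"
            using edges_between_subset[OF I_props(5,6,7)[OF AI]] by blast
        qed
      qed
      fix \<omega> assume \<omega>: "\<forall>i\<in>?J. \<omega> i = \<eta> i" "\<omega> \<in> ?E"
      have LU: "LC ?U \<omega> = LC ?U \<eta>" "LC ?U' \<omega> = LC ?U' \<eta>"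
        using \<omega>(1) by (auto intro!: ext local_cluster_cong)
      have cl: "LC V \<eta> x \<subseteq> {x \<in> V. s \<le> card (LC V \<eta> x)}" if "x \<in> {x \<in> V. s \<le> card (LC V \<eta> x)}" for V x and s :: real
      proof
        fix y assume y: "y \<in> LC V \<eta> x"
        show "y \<in> {x \<in> V. s \<le> card (LC V \<eta> x)}"
          using that local_cluster_subset[of x V N \<eta>] y local_cluster_eqI[OF y] by auto
      qed
      obtain A A' where AA: "A \<subseteq> G" "\<And>x. x \<in> A \<Longrightarrow> LC ?U \<omega> x \<subseteq> A" "card G \<le> 3 * card A"
          "A' \<subseteq> G'" "\<And>x. x \<in> A' \<Longrightarrow> LC ?U' \<omega> x \<subseteq> A'" "card G' \<le> 2 * card A'"
          "\<forall>e\<in>edges_between A A'. \<not> \<omega> e"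
      proof (rule split_without_large_cluster[where g = "q * N ^ n / 3", OF fU hball_sibling_disjoint _ _ _ _ _ _ lat])
        show "card (LC (?U \<union> ?U') \<omega> x) < q * N ^ n / 3" if "x \<in> ?U \<union> ?U'" for x
          using \<omega>(2) that by blast
        show "G \<subseteq> ?U" "G' \<subseteq> ?U'" by (auto simp: G_def G'_def)
        show "LC ?U \<omega> x \<subseteq> G" if "x \<in> G" for x using that cl[of x ?U] unfolding LU G_def by blast
        show "LC ?U' \<omega> x \<subseteq> G'" if "x \<in> G'" for x using that cl[of x ?U'] unfolding LU G'_def by blast
        show "3 * (q * N ^ n / 3) \<le> card G" using cG(1) by (simp add: b_def)
      qed blast
      then have "(A, A') \<in> I" unfolding I_def LU by auto
      then show "\<omega> \<in> D" using AA(7) unfolding D_def Cl_def by blast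
    qed
  qed
qed

text \<open>Both balls have large mass with probability at least \<open>q\<^sup>2\<close> by
  independence, and at most half of that is lost in merging. The cluster obtained lies in the ball
  of radius \<open>Suc n\<close>; symmetry moves it to the sibling of that ball, whence the
  threshold \<open>Suc n0\<close>.\<close>

lemma prob_giant:
  assumes x0: "x0 \<in> hlattice N" and \<theta>: "0 < prob (Inf_event x0 \<inter> space P)"
  obtains \<delta> c :: real and n0 where "0 < \<delta>" "0 < c" "c \<le> 1"
    "\<And>n. n0 \<le> n \<Longrightarrow> c \<le> prob (giant (sibling N n) (\<delta> * N ^ n) \<inter> space P)"
proof -
  define q where "q = prob (Inf_event x0 \<inter> space P) / 4"
  define K where "K = 24 * \<beta> / (\<alpha> * q\<^sup>2)"
  have q: "0 < q" "q \<le> 1" using \<theta> prob_le_1[of "Inf_event x0 \<inter> space P"] unfolding q_def by linarith+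
  have K: "0 \<le> K" using q \<alpha>_pos \<beta>_pos by (simp add: K_def)
  obtain n0 where n0: "\<And>n V. n \<ge> n0 \<Longrightarrow> V \<in> {hball N n, sibling N n} \<Longrightarrow> q \<le> prob (large_mass V K q n \<inter> space P)"
    using prob_large_mass[OF x0 \<theta> K] unfolding q_def by blast
  \<comment> \<open>The factor \<open>N\<close> accounts for the larger ball:
    \<open>\<delta> * N ^ Suc n\<close> equals \<open>q * N ^ n / 3\<close>.\<close>
  define \<delta> where "\<delta> = q / (3 * N)"
  have \<delta>: "0 < \<delta>" using q N2 by (simp add: \<delta>_def)
  have ball: "q\<^sup>2 / 2 \<le> prob (giant (hball N (Suc n)) (\<delta> * N ^ Suc n) \<inter> space P)" if n: "n0 \<le> n" for n
  proof -
    let ?U = "hball N n" and ?U' = "sibling N n"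
    let ?A = "large_mass ?U K q n" and ?A' = "large_mass ?U' K q n"
    let ?E = "{\<omega>. \<forall>x\<in>?U \<union> ?U'. card (LC (?U \<union> ?U') \<omega> x) < q * N ^ n / 3}"
    let ?G = "giant (hball N (Suc n)) (\<delta> * N ^ Suc n)"
    have m: "?A \<inter> space P \<in> sets P" "?A' \<inter> space P \<in> sets P"
      by (rule finite_determined_measurable[OF _ determined_by_large_mass], simp add: finite_hball finite_sibling)+
    have "prob (?A \<inter> ?A' \<inter> space P) = prob (?A \<inter> space P) * prob (?A' \<inter> space P)"
      by (rule determined_by_indep[OF m(1) determined_by_large_mass edges_in_subset
            m(2) determined_by_large_mass edges_in_subset edges_disjoint[OF hball_sibling_disjoint]])
    also have "\<dots> \<ge> q * q" using n0[OF n] q by (intro mult_mono) auto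
    finally have AA: "q\<^sup>2 \<le> prob (?A \<inter> ?A' \<inter> space P)" by (simp add: power2_eq_square)
    have gm: "?G \<inter> space P \<in> sets P"
      by (rule finite_determined_measurable[OF finite_hball determined_by_giant])
    have em: "?A \<inter> ?A' \<inter> ?E \<inter> space P \<in> sets P"
    proof -
      have "?A \<inter> ?A' \<inter> ?E \<inter> space P = (?A \<inter> space P) \<inter> (?A' \<inter> space P) \<inter> (?E \<inter> space P)" by blast
      moreover have "?E \<inter> space P \<in> sets P" by (intro local_event_measurable) (simp add: finite_hball finite_sibling)
      ultimately show ?thesis using m by (simp only: sets.Int)
    qed
    have W: "?U \<union> ?U' \<subseteq> hball N (Suc n)" using hball_mono[of n "Suc n" N] sibling_subset by auto
    have "prob (?A \<inter> ?A' \<inter> space P) \<le> prob ((?A \<inter> ?A' \<inter> ?E \<inter> space P) \<union> (?G \<inter> space P))"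
    proof (rule finite_measure_mono[OF _ sets.Un[OF em gm]])
      have "\<omega> \<in> ?G" if nE: "\<omega> \<notin> ?E" for \<omega>
      proof -
        obtain x where x: "x \<in> ?U \<union> ?U'" "q * N ^ n / 3 \<le> card (LC (?U \<union> ?U') \<omega> x)" using nE by force
        have "card (LC (?U \<union> ?U') \<omega> x) \<le> card (LC (hball N (Suc n)) \<omega> x)"
          by (intro card_mono finite_local_cluster finite_hball local_cluster_mono W)
        then have "q * N ^ n / 3 \<le> card (LC (hball N (Suc n)) \<omega> x)" using x(2) by linarith
        moreover have "q * N ^ n / 3 = \<delta> * N ^ Suc n" using N2 by (simp add: \<delta>_def)
        moreover have "x \<in> hball N (Suc n)" using x(1) W by blast
        ultimately show ?thesis unfolding giant_def by (metis (mono_tags, lifting) mem_Collect_eq)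
      qed
      then show "?A \<inter> ?A' \<inter> space P \<subseteq> (?A \<inter> ?A' \<inter> ?E \<inter> space P) \<union> (?G \<inter> space P)" by blast
    qed
    also have "\<dots> \<le> prob (?A \<inter> ?A' \<inter> ?E \<inter> space P) + prob (?G \<inter> space P)"
      by (rule measure_Un_le[OF em gm])
    also have "prob (?A \<inter> ?A' \<inter> ?E \<inter> space P) \<le> 1 / 2 * prob (?A \<inter> ?A' \<inter> space P)"
      using prob_no_large_cluster[OF q(1), of n] unfolding K_def .
    finally show ?thesis using AA by linarith
  qed
  have sib: "q\<^sup>2 / 2 \<le> prob (giant (sibling N n) (\<delta> * N ^ n) \<inter> space P)" if n: "Suc n0 \<le> n" for n
  proof -
    obtain m where m: "n = Suc m" "n0 \<le> m" using n by (cases n) auto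
    define b where "b = (\<lambda>i. if i = n then 1 else 0 :: nat)"
    note sw = swap_map_image_sibling(1)[OF N2] swap_map_image_sibling(2,3)[OF N2, of n, folded b_def]
    have "prob (giant (sibling N n) (\<delta> * N ^ n) \<inter> space P) = prob (giant (hball N n) (\<delta> * N ^ n) \<inter> space P)"
      using prob_swap_map[OF sw(1,2) finite_hball[of N n], of "\<lambda>f. \<exists>x\<in>hball N n. \<delta> * N ^ n \<le> f x"]
      unfolding giant_def sw(3)[symmetric] by simp
    then show ?thesis using ball[OF m(2)] m(1) by simp
  qed
  have "0 < q\<^sup>2 / 2" "q\<^sup>2 / 2 \<le> 1" using q power_le_one[of q 2] by auto
  then show thesis by (rule that[OF \<delta> _ _ sib])
qed

end


section \<open>Uniqueness\<close>

context hierarchical_percolation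
begin

text \<open>The clusters of \<open>x\<close> and \<open>y\<close> in the ball are frozen at
  \<open>\<eta>\<close>, so \<open>D\<close> involves only edges inside the sibling ball or between
  the two balls. If the sibling has a giant cluster, each of the two connections to it fails with
  probability at most \<open>1 / 4\<close>, so both are present with probability at least
  \<open>1 / 2\<close>.\<close>

lemma prob_not_joined:
  fixes \<delta> :: real
  assumes n: "x \<in> hball N n" "y \<in> hball N n" and \<delta>: "0 < \<delta>"
    and large: "2 * \<beta> / (\<alpha> * \<delta>) \<le> card (LC (hball N n) \<eta> x) * w n"
      "2 * \<beta> / (\<alpha> * \<delta>) \<le> card (LC (hball N n) \<eta> y) * w n"
  defines "D \<equiv> {\<omega>. \<not> (\<exists>z\<in>sibling N n.
    (\<exists>e\<in>edges_between (LC (hball N n) \<eta> x) (LC (sibling N n) \<omega> z). \<omega> e) \<and>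
    (\<exists>e\<in>edges_between (LC (hball N n) \<eta> y) (LC (sibling N n) \<omega> z). \<omega> e))}"
  shows "D \<inter> space P \<in> sets P" "determined_by (hedges N - edges_in N (hball N n)) D"
    "prob (D \<inter> space P) \<le> 1 - prob (giant (sibling N n) (\<delta> * N ^ n) \<inter> space P) / 2"
proof -
  let ?U = "hball N n" and ?V = "sibling N n"
  let ?S = "\<lambda>x. LC ?U \<eta> x"
  let ?J = "edges_in N ?V \<union> edges_between ?U ?V"
  let ?G = "giant ?V (\<delta> * N ^ n)"
  have S: "?S x \<subseteq> ?U" "?S y \<subseteq> ?U" using local_cluster_subset n by blast+
  have lat: "?U \<subseteq> hlattice N" "?V \<subseteq> hlattice N" by (rule hball_subset sibling_lattice)+
  have eb: "edges_between ?U ?V \<subseteq> hedges N" by (rule edges_between_subset[OF lat hball_sibling_disjoint])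
  have J: "finite ?J" "?J \<subseteq> hedges N"
    using finite_edges_in[OF finite_sibling] finite_edges_between[OF finite_hball finite_sibling] edges_in_subset eb by auto
  have detJ: "determined_by ?J D"
    unfolding determined_by_def
  proof (intro allI impI)
    fix \<omega> \<omega>' :: "(nat \<Rightarrow> nat) set \<Rightarrow> bool" assume eq: "\<forall>e\<in>?J. \<omega> e = \<omega>' e"
    have L: "LC ?V \<omega> z = LC ?V \<omega>' z" for z using eq by (intro local_cluster_cong) auto
    have E: "\<omega> e = \<omega>' e" if "e \<in> edges_between (?S u) (LC ?V \<omega>' z)" "u \<in> {x, y}" "z \<in> ?V" for e u z
    proof -
      have "e \<in> edges_between ?U ?V"
        using that S local_cluster_subset[OF that(3), of N \<omega>'] unfolding edges_between_def by blast
      then show ?thesis using eq by blast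
    qed
    have E2: "(\<exists>e\<in>edges_between (?S u) (LC ?V \<omega>' z). \<omega> e) \<longleftrightarrow> (\<exists>e\<in>edges_between (?S u) (LC ?V \<omega>' z). \<omega>' e)"
      if "u \<in> {x, y}" "z \<in> ?V" for u z using E[OF _ that] by blast
    show "\<omega> \<in> D \<longleftrightarrow> \<omega>' \<in> D" unfolding D_def mem_Collect_eq L using E2 by (metis insertCI)
  qed
  show Dm: "D \<inter> space P \<in> sets P" by (rule determined_by_measurable[OF J detJ])
  have "?J \<inter> edges_in N ?U = {}"
  proof -
    have "edges_between ?U ?V \<inter> edges_in N ?U = {}"
      using hball_sibling_disjoint[of n] by (auto simp: edges_between_def edges_in_def)
    then show ?thesis using edges_disjoint[OF hball_sibling_disjoint[of n]] by blast
  qed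
  then show "determined_by (hedges N - edges_in N ?U) D"
    using J(2) by (intro determined_by_mono[OF detJ]) blast
  have Gm: "?G \<inter> space P \<in> sets P" by (rule finite_determined_measurable[OF finite_sibling determined_by_giant])
  \<comment> \<open>Conditioning on the inside of the sibling ball fixes the giant cluster
    \<open>L\<close>; only its edges to the two frozen clusters remain random.\<close>
  have half: "prob (?G \<inter> D \<inter> space P) \<le> 1 / 2 * prob (?G \<inter> space P)"
  proof (rule prob_Int_le_of_atoms[OF finite_edges_in[OF finite_sibling] edges_in_subset determined_by_giant Dm])
    fix \<xi> assume "\<xi> \<in> ?G" "\<xi> \<in> space P"
    then obtain z where z: "z \<in> ?V" "\<delta> * N ^ n \<le> card (LC ?V \<xi> z)" by (auto simp: giant_def)
    define L where "L = LC ?V \<xi> z"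
    have LV: "L \<subseteq> ?V" using local_cluster_subset[OF z(1)] by (simp add: L_def)
    define Cl where "Cl u = {\<omega>. \<forall>e\<in>edges_between (?S u) L. \<not> \<omega> e}" for u
    have Sp: "finite (?S u)" "finite L" "?S u \<subseteq> hlattice N" "L \<subseteq> hlattice N" "?S u \<inter> L = {}" "?S u \<subseteq> ?U" if "u \<in> {x, y}" for u
    proof -
      show *: "?S u \<subseteq> ?U" using S that by auto
      show "finite (?S u)" "finite L" using * LV finite_hball finite_sibling finite_subset by blast+
      show "?S u \<subseteq> hlattice N" "L \<subseteq> hlattice N" using * LV lat by blast+
      show "?S u \<inter> L = {}" using * LV hball_sibling_disjoint by blast
    qed
    have Clm: "Cl u \<inter> space P \<in> sets P" if "u \<in> {x, y}" for u
      unfolding Cl_def by (rule closed_between_measurable[OF Sp(1-5)[OF that]])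
    have Clp: "prob (Cl u \<inter> space P) \<le> 1 / 4" if u: "u \<in> {x, y}" for u
    proof -
      have "prob (Cl u \<inter> space P) = exp (- (\<alpha> / \<beta> ^ Suc n * (card (?S u) * card L)))"
        unfolding Cl_def
      proof (rule prob_closed_between[OF Sp(1-5)[OF u]])
        show "hdist a b = Suc n" if "a \<in> ?S u" "b \<in> L" for a b
          using that Sp(6)[OF u] LV by (intro hdist_hball_sibling) auto
      qed
      also have "\<dots> \<le> exp (- 2)"
      proof -
        \<comment> \<open>The threshold is the one that makes the exponent at least 2, whence the
          bound \<open>exp (- 2) \<le> 1 / 4\<close>.\<close>
        have "2 * \<beta> / (\<alpha> * \<delta>) \<le> card (?S u) * w n" using u large by auto
        then have "2 \<le> \<alpha> * \<delta> / \<beta> * (card (?S u) * w n)"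
          using \<alpha>_pos \<beta>_pos \<delta> by (simp add: field_simps)
        also have "\<dots> = \<alpha> / \<beta> ^ Suc n * (real (card (?S u)) * (\<delta> * N ^ n))"
          by (simp add: w_def power_divide mult_ac)
        also have "\<dots> \<le> \<alpha> / \<beta> ^ Suc n * (real (card (?S u)) * real (card L))"
          using z(2) \<alpha>_pos \<beta>_pos by (intro mult_left_mono) (auto simp: L_def)
        finally show ?thesis by simp
      qed
      also have "\<dots> \<le> 1 / 4" using exp_2_ge by (simp add: exp_minus field_simps)
      finally show ?thesis .
    qed
    show "\<exists>D'. D' \<inter> space P \<in> sets P \<and> determined_by (hedges N - edges_in N ?V) D' \<and> prob (D' \<inter> space P) \<le> 1 / 2 \<and>
      (\<forall>\<omega>\<in>space P. (\<forall>e\<in>edges_in N ?V. \<omega> e = \<xi> e) \<longrightarrow> \<omega> \<in> D \<longrightarrow> \<omega> \<in> D')"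
    proof (intro exI[of _ "Cl x \<union> Cl y"] conjI ballI impI)
      have eq: "(Cl x \<union> Cl y) \<inter> space P = (Cl x \<inter> space P) \<union> (Cl y \<inter> space P)" by blast
      show "(Cl x \<union> Cl y) \<inter> space P \<in> sets P" unfolding eq by (intro sets.Un Clm) auto
      have "prob ((Cl x \<union> Cl y) \<inter> space P) \<le> prob (Cl x \<inter> space P) + prob (Cl y \<inter> space P)"
        unfolding eq by (intro measure_Un_le Clm) auto
      then show "prob ((Cl x \<union> Cl y) \<inter> space P) \<le> 1 / 2" using Clp[of x] Clp[of y] by simp
      have "determined_by (hedges N - edges_in N ?V) (Cl u)" if u: "u \<in> {x, y}" for u
      proof (rule determined_by_mono)
        show "determined_by (edges_between (?S u) L) (Cl u)" by (auto simp: Cl_def determined_by_def)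
        have "e \<notin> edges_in N ?V" if "e \<in> edges_between (?S u) L" for e
          using that Sp(6)[OF u] hball_sibling_disjoint[of n] by (auto simp: edges_between_def edges_in_def)
        then show "edges_between (?S u) L \<subseteq> hedges N - edges_in N ?V"
          using edges_between_subset[OF Sp(3-5)[OF u]] by blast
      qed
      then show "determined_by (hedges N - edges_in N ?V) (Cl x \<union> Cl y)" by (intro determined_by_Un) auto
      fix \<omega> assume "\<forall>e\<in>edges_in N ?V. \<omega> e = \<xi> e" and D: "\<omega> \<in> D"
      then have L: "LC ?V \<omega> z = L" unfolding L_def by (intro local_cluster_cong) auto
      show "\<omega> \<in> Cl x \<union> Cl y" using D z(1) L unfolding D_def Cl_def by auto
    qed
  qed
  have GD: "?G \<inter> D \<inter> space P \<in> sets P"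
  proof -
    have "?G \<inter> D \<inter> space P = (?G \<inter> space P) \<inter> (D \<inter> space P)" by blast
    then show ?thesis using Gm Dm by (simp only: sets.Int)
  qed
  have GC: "space P - (?G \<inter> space P) \<in> sets P" using Gm by (rule sets.compl_sets)
  have "prob (D \<inter> space P) \<le> prob ((?G \<inter> D \<inter> space P) \<union> (space P - (?G \<inter> space P)))"
    by (rule finite_measure_mono[OF _ sets.Un[OF GD GC]]) blast
  also have "\<dots> \<le> prob (?G \<inter> D \<inter> space P) + prob (space P - (?G \<inter> space P))"
    by (rule measure_Un_le[OF GD GC])
  also have "prob (space P - (?G \<inter> space P)) = 1 - prob (?G \<inter> space P)" by (rule prob_compl[OF Gm])
  finally show "prob (D \<inter> space P) \<le> 1 - prob (?G \<inter> space P) / 2" using half by linarith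
qed

text \<open>At every large scale, either a local cluster is small, which is asymptotically
  incompatible with an infinite cluster, or both are large and get joined through the sibling ball
  with conditional probability bounded below.\<close>

lemma prob_distinct_infinite_clusters:
  assumes x: "x \<in> hlattice N" and y: "y \<in> hlattice N"
  shows "prob ({\<omega>. infinite (cluster N \<omega> x) \<and> infinite (cluster N \<omega> y) \<and> y \<notin> cluster N \<omega> x} \<inter> space P) = 0"
    and "{\<omega>. infinite (cluster N \<omega> x) \<and> infinite (cluster N \<omega> y) \<and> y \<notin> cluster N \<omega> x} \<inter> space P \<in> sets P"
proof -
  let ?E = "{\<omega>. infinite (cluster N \<omega> x) \<and> infinite (cluster N \<omega> y) \<and> y \<notin> cluster N \<omega> x}"
  have Eeq: "?E \<inter> space P = (Inf_event x \<inter> space P) \<inter> (Inf_event y \<inter> space P) \<inter> (space P - ({\<omega>. y \<in> cluster N \<omega> x} \<inter> space P))"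
    by (auto simp: Inf_event_def)
  show Em: "?E \<inter> space P \<in> sets P"
    unfolding Eeq by (intro sets.Int sets.compl_sets Inf_event_measurable connected_measurable)
  show "prob (?E \<inter> space P) = 0"
  proof (cases "0 < prob (Inf_event x \<inter> space P)")
    case False
    have "prob (?E \<inter> space P) \<le> prob (Inf_event x \<inter> space P)"
      by (rule finite_measure_mono[OF _ Inf_event_measurable]) (auto simp: Inf_event_def)
    then have "prob (?E \<inter> space P) \<le> 0" using False by linarith
    then show ?thesis by (simp add: measure_le_0_iff)
  next
    case True
    obtain \<delta> c :: real and n0 where \<delta>: "0 < \<delta>" and c: "0 < c" "c \<le> 1"
      and n0: "\<And>n. n0 \<le> n \<Longrightarrow> c \<le> prob (giant (sibling N n) (\<delta> * N ^ n) \<inter> space P)"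
      using prob_giant[OF x True] by blast
    define K where "K = 2 * \<beta> / (\<alpha> * \<delta>)"
    have K: "0 \<le> K" using \<alpha>_pos \<beta>_pos \<delta> by (simp add: K_def)
    let ?good = "\<lambda>n u. {\<omega>. K \<le> card (LC (hball N n) \<omega> u) * w n}"
    let ?bad = "\<lambda>n u. {\<omega>. card (LC (hball N n) \<omega> u) * w n < K}"
    let ?A = "\<lambda>n. ?good n x \<inter> ?good n y"
    obtain n1 n2 where n12: "x \<in> hball N n1" "y \<in> hball N n2" using x y unfolding UN_hball[symmetric] by blast
    \<comment> \<open>On \<open>?A n\<close>, any configuration in the ball leaves probability at
      least \<open>c / 2\<close> for joining \<open>x\<close> and \<open>y\<close> by outside edges,
      so the conditional probability of \<open>?E\<close> stays below
      \<open>1 - c / 2\<close>.\<close>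
    have "(\<lambda>n. prob (?A n \<inter> ?E \<inter> space P)) \<longlonglongrightarrow> 0"
    proof (rule prob_Int_tendsto_0[OF edges_in_hball_exhaust Em])
      show "determined_by (edges_in N (hball N n)) (?A n)" for n
        by (intro determined_by_Int determined_by_local_cluster)
      show "0 < c / 2" "c / 2 \<le> 1" using c by auto
      fix n B assume n: "max n0 (max n1 n2) \<le> n" and B: "determined_by (edges_in N (hball N n)) B" and BA: "B \<subseteq> ?A n"
      have xy: "x \<in> hball N n" "y \<in> hball N n"
        using n12 n hball_mono[of n1 n N] hball_mono[of n2 n N] by auto
      show "prob (B \<inter> ?E \<inter> space P) \<le> (1 - c / 2) * prob (B \<inter> space P)"
      proof (rule prob_Int_le_of_atoms[OF edges_in_hball_exhaust(1,2) B Em])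
        fix \<eta> assume "\<eta> \<in> B" "\<eta> \<in> space P"
        then have l: "2 * \<beta> / (\<alpha> * \<delta>) \<le> card (LC (hball N n) \<eta> x) * w n"
          "2 * \<beta> / (\<alpha> * \<delta>) \<le> card (LC (hball N n) \<eta> y) * w n" using BA by (auto simp: K_def)
        define D where "D = {\<omega>. \<not> (\<exists>z\<in>sibling N n.
          (\<exists>e\<in>edges_between (LC (hball N n) \<eta> x) (LC (sibling N n) \<omega> z). \<omega> e) \<and>
          (\<exists>e\<in>edges_between (LC (hball N n) \<eta> y) (LC (sibling N n) \<omega> z). \<omega> e))}"
        note nj = prob_not_joined[OF xy \<delta> l, folded D_def]
        show "\<exists>D. D \<inter> space P \<in> sets P \<and> determined_by (hedges N - edges_in N (hball N n)) D \<and>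
          prob (D \<inter> space P) \<le> 1 - c / 2 \<and>
          (\<forall>\<omega>\<in>space P. (\<forall>e\<in>edges_in N (hball N n). \<omega> e = \<eta> e) \<longrightarrow> \<omega> \<in> ?E \<longrightarrow> \<omega> \<in> D)"
        proof (intro exI[of _ D] conjI ballI impI nj(1,2))
          show "prob (D \<inter> space P) \<le> 1 - c / 2" using nj(3) n0[of n] n by linarith
          fix \<omega> assume eq: "\<forall>e\<in>edges_in N (hball N n). \<omega> e = \<eta> e" and E: "\<omega> \<in> ?E"
          show "\<omega> \<in> D"
          proof (rule ccontr)
            assume "\<omega> \<notin> D"
            then obtain z e e' where z: "z \<in> sibling N n"
              and e: "e \<in> edges_between (LC (hball N n) \<eta> x) (LC (sibling N n) \<omega> z)" "\<omega> e"
              and e': "e' \<in> edges_between (LC (hball N n) \<eta> y) (LC (sibling N n) \<omega> z)" "\<omega> e'"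
              unfolding D_def by blast
            have L: "LC (hball N n) \<eta> u = LC (hball N n) \<omega> u" for u using eq by (intro local_cluster_cong) auto
            have join: "cluster N \<omega> u = cluster N \<omega> z"
              if u: "u \<in> hball N n" and f: "f \<in> edges_between (LC (hball N n) \<eta> u) (LC (sibling N n) \<omega> z)" "\<omega> f" for u f
            proof -
              obtain a b where ab: "f = {a, b}" "a \<in> LC (hball N n) \<omega> u" "b \<in> LC (sibling N n) \<omega> z"
                using f(1) unfolding L edges_between_def by blast
              have mem: "a \<in> hball N n" "b \<in> sibling N n"
                using ab local_cluster_subset[OF u] local_cluster_subset[OF z] by blast+
              have "a \<noteq> b" using mem hball_sibling_disjoint[of n] by blast
              then have "adjacent N \<omega> a b"
                using mem f(2) ab(1) hball_subset[of N n] sibling_lattice[of n] by (auto simp: adjacent_def doubleton_in_hedges)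
              then have "b \<in> cluster N \<omega> a" by (simp add: cluster_def r_into_rtranclp)
              then have "cluster N \<omega> b = cluster N \<omega> a" by (rule cluster_eqI)
              moreover have "cluster N \<omega> a = cluster N \<omega> u" "cluster N \<omega> b = cluster N \<omega> z"
                by (rule cluster_eqI[OF subsetD[OF local_cluster_subset_cluster]], rule ab)+
              ultimately show ?thesis by simp
            qed
            have "cluster N \<omega> x = cluster N \<omega> y" using join[OF xy(1) e] join[OF xy(2) e'] by simp
            moreover have "y \<in> cluster N \<omega> y" by (simp add: cluster_def)
            ultimately show False using E by simp
          qed
        qed
      qed
    qed
    then have lim: "(\<lambda>n. prob (?A n \<inter> ?E \<inter> space P) + prob (?bad n x \<inter> Inf_event x \<inter> space P)
        + prob (?bad n y \<inter> Inf_event y \<inter> space P)) \<longlonglongrightarrow> 0 + 0 + 0"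
      by (intro tendsto_add infinite_cluster_locally_large x y K)
    \<comment> \<open>The left side does not depend on \<open>n\<close>, and each of the three terms
      on the right vanishes in the limit.\<close>
    have "prob (?E \<inter> space P) \<le> prob (?A n \<inter> ?E \<inter> space P) + prob (?bad n x \<inter> Inf_event x \<inter> space P)
        + prob (?bad n y \<inter> Inf_event y \<inter> space P)" for n
    proof -
      have bm: "?bad n u \<inter> Inf_event u \<inter> space P \<in> sets P" for u
      proof -
        have "?bad n u \<inter> Inf_event u \<inter> space P = (?bad n u \<inter> space P) \<inter> (Inf_event u \<inter> space P)" by blast
        then show ?thesis
          using local_event_measurable[OF finite_hball[of N n], of "\<lambda>f. card (f u) * w n < K"] Inf_event_measurable
          by (simp only: sets.Int)
      qed
      have am: "?A n \<inter> ?E \<inter> space P \<in> sets P"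
      proof -
        have "?A n \<inter> ?E \<inter> space P = (?A n \<inter> space P) \<inter> (?E \<inter> space P)" by blast
        moreover have "?A n \<inter> space P \<in> sets P"
          by (rule finite_determined_measurable[OF finite_hball[of N n]]) (intro determined_by_Int determined_by_local_cluster)
        ultimately show ?thesis using Em by (simp only: sets.Int)
      qed
      have "prob (?E \<inter> space P) \<le> prob ((?A n \<inter> ?E \<inter> space P) \<union> (?bad n x \<inter> Inf_event x \<inter> space P)
          \<union> (?bad n y \<inter> Inf_event y \<inter> space P))"
        by (rule finite_measure_mono[OF _ sets.Un[OF sets.Un[OF am bm] bm]]) (auto simp: Inf_event_def)
      also have "\<dots> \<le> prob ((?A n \<inter> ?E \<inter> space P) \<union> (?bad n x \<inter> Inf_event x \<inter> space P)) + prob (?bad n y \<inter> Inf_event y \<inter> space P)"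
        by (rule measure_Un_le[OF sets.Un[OF am bm] bm])
      also have "prob ((?A n \<inter> ?E \<inter> space P) \<union> (?bad n x \<inter> Inf_event x \<inter> space P))
          \<le> prob (?A n \<inter> ?E \<inter> space P) + prob (?bad n x \<inter> Inf_event x \<inter> space P)"
        by (rule measure_Un_le[OF am bm])
      finally show ?thesis by simp
    qed
    then have "prob (?E \<inter> space P) \<le> 0 + 0 + 0" by (intro LIMSEQ_le_const[OF lim]) auto
    then show ?thesis by (simp add: measure_le_0_iff)
  qed
qed

text \<open>There are countably many pairs of vertices, so almost surely no pair represents two
  distinct infinite clusters.\<close>

lemma AE_unique_infinite_cluster:
  "AE \<omega> in P. \<exists>\<^sub>\<le>\<^sub>1 C. C \<in> clusters N \<omega> \<and> infinite C"
proof -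
  have "AE \<omega> in P. \<not> (infinite (cluster N \<omega> x) \<and> infinite (cluster N \<omega> y) \<and> y \<notin> cluster N \<omega> x)"
    if "x \<in> hlattice N" "y \<in> hlattice N" for x y
  proof (rule AE_I')
    let ?E = "{\<omega>. infinite (cluster N \<omega> x) \<and> infinite (cluster N \<omega> y) \<and> y \<notin> cluster N \<omega> x} \<inter> space P"
    show "?E \<in> null_sets P"
      using prob_distinct_infinite_clusters[OF that] by (auto simp: null_sets_def emeasure_eq_measure)
    show "{\<omega> \<in> space P. \<not> \<not> (infinite (cluster N \<omega> x) \<and> infinite (cluster N \<omega> y) \<and> y \<notin> cluster N \<omega> x)} \<subseteq> ?E" by auto
  qed
  then have "AE \<omega> in P. \<forall>x\<in>hlattice N. \<forall>y\<in>hlattice N.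
      \<not> (infinite (cluster N \<omega> x) \<and> infinite (cluster N \<omega> y) \<and> y \<notin> cluster N \<omega> x)"
    by (intro AE_ball_countable' countable_hlattice)
  then show ?thesis
  proof (rule AE_mp, intro AE_I2 impI)
    fix \<omega>
    assume *: "\<forall>x\<in>hlattice N. \<forall>y\<in>hlattice N.
      \<not> (infinite (cluster N \<omega> x) \<and> infinite (cluster N \<omega> y) \<and> y \<notin> cluster N \<omega> x)"
    show "\<exists>\<^sub>\<le>\<^sub>1 C. C \<in> clusters N \<omega> \<and> infinite C"
    proof (rule Uniq_I)
      fix C C' assume "C \<in> clusters N \<omega> \<and> infinite C" "C' \<in> clusters N \<omega> \<and> infinite C'"
      then obtain x y where "x \<in> hlattice N" "C = cluster N \<omega> x" "y \<in> hlattice N" "C' = cluster N \<omega> y"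
        "infinite C" "infinite C'" by (auto simp: clusters_def)
      then show "C = C'" using * cluster_eqI by metis
    qed
  qed
qed

end

section \<open>The edgeless case \<open>\<alpha> = 0\<close> and the conclusion\<close>

lemma AE_no_infinite_cluster_zero:
  assumes "0 < \<beta>"
  shows "AE \<omega> in percolation N 0 \<beta>. \<forall>C\<in>clusters N \<omega>. finite C"
proof -
  interpret prob_space "percolation N 0 \<beta>" by (rule prob_space_percolation)
  have "AE \<omega> in percolation N 0 \<beta>. \<not> \<omega> e" if e: "e \<in> hedges N" for e
  proof -
    obtain x y where xy: "e = {x, y}" "x \<in> hlattice N" "y \<in> hlattice N" "x \<noteq> y" using e by (auto simp: hedges_def)
    have "(\<lambda>\<omega>. \<omega> e) \<in> percolation N 0 \<beta> \<rightarrow>\<^sub>M count_space UNIV"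
      using measurable_component_singleton[OF e, of "\<lambda>e. measure_pmf (bernoulli_pmf (edge_prob 0 \<beta> (edge_length e)))"]
      by (simp add: percolation_def)
    then have "{\<omega> \<in> space (percolation N 0 \<beta>). \<omega> e} \<in> events" by measurable
    moreover have "prob {\<omega> \<in> space (percolation N 0 \<beta>). \<omega> e} = 0"
      using prob_edge_open[of 0 \<beta> x N y] xy assms by (simp add: edge_prob_def)
    ultimately show ?thesis by (intro AE_I[of _ _ "{\<omega> \<in> space (percolation N 0 \<beta>). \<omega> e}"]) (auto simp: emeasure_eq_measure)
  qed
  then have "AE \<omega> in percolation N 0 \<beta>. \<forall>e\<in>hedges N. \<not> \<omega> e"
    using countable_hedges by (simp add: AE_ball_countable)
  then show ?thesis
  proof (rule AE_mp, intro AE_I2 impI)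
    fix \<omega> assume closed: "\<forall>e\<in>hedges N. \<not> \<omega> e"
    have "cluster N \<omega> x \<subseteq> {x}" for x
    proof
      fix y assume "y \<in> cluster N \<omega> x"
      then have "(adjacent N \<omega>)\<^sup>*\<^sup>* x y" by (simp add: cluster_def)
      then show "y \<in> {x}"
        by (induction rule: rtranclp_induct) (use closed in \<open>auto simp: adjacent_def\<close>)
    qed
    then show "\<forall>C\<in>clusters N \<omega>. finite C" by (auto simp: clusters_def intro: finite_subset)
  qed
qed

theorem theorem2:
  fixes N :: nat and \<alpha> \<beta> :: real
  assumes "2 \<le> N" and "0 \<le> \<alpha>" and "0 < \<beta>"
  shows "AE \<omega> in percolation N \<alpha> \<beta>. \<exists>\<^sub>\<le>\<^sub>1 C. C \<in> clusters N \<omega> \<and> infinite C"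
proof (cases "\<alpha> = 0")
  case True
  show ?thesis
    using AE_no_infinite_cluster_zero[OF assms(3), of N] unfolding True
    by (rule AE_mp) (auto intro!: AE_I2 simp: Uniq_def)
next
  case False
  then interpret hierarchical_percolation N \<alpha> \<beta>
    using assms by unfold_locales auto
  show ?thesis unfolding percolation_eq by (rule AE_unique_infinite_cluster)
qed

end
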